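(* Consider the constrained convex program and its standing assumptions (i)–(iv) described in the context, and let $\{(x^k,z^k)\}$ be generated by the single-loop algorithm described in the context, where the parameters satisfy the following (open-loop) conditions: the positive sequence $\{\lambda_k\}$ is increasing, $\lambda_k=\Theta(k^{\tau})$ and $\lambda_{k+1}-\lambda_k=\mathcal{O}(k^{-(1-\tau)})$ for some $\tau\in(0,1)$; the stepsizes $\{\alpha_k\}\subset(0,1]$ are nonincreasing with $\alpha_k=\Theta(k^{-p})$ where $p\in(\tau,1)$; and the positive sequence $\{\sigma_k\}$ satisfies $\sigma_k\le\lambda_k$ and $\sigma_k=\Theta(k^{-(1+\gamma)})$ for some $\gamma>0$. Let $L^*$ be the optimal value of the program. Then $$\max\{|f(x^k)+h(x^k)-L^*|,\ \|[g(x^k)]_+\|\}=\mathcal{O}(\max\{k^{-(p-\tau)},k^{-\tau}\}).$$ If, in addition, the program has a Slater point (i.e., there is $\tilde x\in\mathrm{dom}\,h$ with $g_i(\tilde x)<0$ for all $i$), then there exists a subsequence of $\{(x^k,[\lambda_k g(x^k)+z^k]_+)\}$ such that all of its cluster points are KKT points of the program.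
   Context: Conventions: $\|\cdot\|$ is the Euclidean norm, vector inequalities and maxima are componentwise, $[a]_+=\max\{a,0\}$ (componentwise for vectors), $\mathrm{dom}\,h=\{x:h(x)<\infty\}$. Asymptotic notation is as $k\to\infty$. Problem: $\min_{x\in\mathbb{R}^n} f(x)+h(x)$ subject to $g(x):=(g_1(x),\dots,g_m(x))^T\le 0$. Standing assumptions: (i) $f:\mathbb{R}^n\to\mathbb{R}$ is convex and differentiable with $L_f$-Lipschitz gradient, $L_f>0$. (ii) $h:\mathbb{R}^n\to(-\infty,+\infty]$ is proper, closed, convex, $\sup_{x,x'\in\mathrm{dom}\,h}\|x-x'\|\le D$ for some finite $D>0$, and for every $u\in\mathbb{R}^n$ the problem $\min_v\langle v,u\rangle+h(v)$ has a minimizer. (iii) Each $g_i:\mathbb{R}^n\to\mathbb{R}$ is convex and differentiable, and there is $L_{g_i}>0$ with $\|\nabla g_i(x)-\nabla g_i(x')\|\le L_{g_i}\|x-x'\|$ for all $x,x'\in\mathrm{dom}\,h$. (iv) There is a KKT point $(x^*,z^* )$: $0\in\nabla f(x^* )+\partial h(x^* )+\sum_{i=1}^m z_i^*\nabla g_i(x^* )$, $g(x^* )\le 0$, $z^*\ge 0$, $\langle z^*,g(x^* )\rangle=0$. For $\lambda>0$, let $\Psi_\lambda(x,z)=\frac{\lambda}{2}\sum_{i=1}^m\big([g_i(x)+z_i/\lambda]_+^2-(z_i/\lambda)^2\big)$ and $F_\lambda(x,z)=f(x)+\Psi_\lambda(x,z)$, so $\nabla_xF_\lambda(x,z)=\nabla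 f(x)+\sum_{i=1}^m[\lambda g_i(x)+z_i]_+\nabla g_i(x)$. Algorithm: choose $(x^0,z^0)\in\mathrm{dom}\,h\times\mathbb{R}^m_+$, a positive increasing sequence $\{\lambda_k\}$ ($\lambda_{k+1}>\lambda_k>0$) with $\lambda_k\to\infty$, a positive summable sequence $\{\sigma_k\}$ with $\sigma_k\le\lambda_k$, and stepsizes $\alpha_k\in[0,1]$. For $k=0,1,2,\dots$: $v^k\in\mathrm{Argmin}_{v}\ \langle\nabla_xF_{\lambda_k}(x^k,z^k),v\rangle+h(v)$ (any minimizer); $x^{k+1}=x^k+\alpha_k(v^k-x^k)$; $z^{k+1}=z^k+\sigma_k\max\{-z^k/\lambda_k,\ g(x^{k+1})\}$. *)

theory Defs
  imports "HOL-Analysis.Analysis" "HOL-Library.Landau_Symbols"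
begin

text \<open>Only meaningful where \<open>f\<close> is differentiable (see \<open>GDERIV_gradient\<close> below).\<close>

definition gradient :: "('a::real_inner \<Rightarrow> real) \<Rightarrow> 'a \<Rightarrow> 'a" where
  "gradient f x = (THE d. GDERIV f x :> d)"

lemma GDERIV_unique:
  assumes "GDERIV f x :> d" and "GDERIV f x :> d'"
  shows "d = d'"
proof -
  have "(\<lambda>y. inner y d) = (\<lambda>y. inner y d')"
    using assms unfolding gderiv_def by (rule has_derivative_unique)
  then have "\<And>y. inner y d = inner y d'" by metis
  then have "inner (d - d') (d - d') = 0" by (simp add: inner_diff_right)
  then show ?thesis by simp
qed

lemma gradient_eqI: "GDERIV f x :> d \<Longrightarrow> gradient f x = d"
  unfolding gradient_def by (blast intro: GDERIV_unique)

lemma GDERIV_gradient: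
  fixes f :: "'a::euclidean_space \<Rightarrow> real"
  assumes "f differentiable (at x)"
  shows "GDERIV f x :> gradient f x"
proof -
  obtain f' where f': "(f has_derivative f') (at x)"
    using assms unfolding differentiable_def by blast
  interpret bounded_linear f' using f' by (rule has_derivative_bounded_linear)
  define d where "d = (\<Sum>b\<in>Basis. f' b *\<^sub>R b)"
  have "f' y = inner y d" for y
  proof -
    have "f' y = f' (\<Sum>b\<in>Basis. inner y b *\<^sub>R b)" by (simp add: euclidean_representation)
    also have "\<dots> = inner y d" by (simp add: sum scaleR d_def inner_sum_right mult.commute)
    finally show ?thesis .
  qed
  then have "f' = (\<lambda>y. inner y d)" by blast
  then have "GDERIV f x :> d" using f' unfolding gderiv_def by simp
  then show ?thesis using gradient_eqI by metis
qed

definition effective_domain :: "('a \<Rightarrow> ereal) \<Rightarrow> 'a set" where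
  "effective_domain h = {x. h x < \<infinity>}"

definition proper_fun :: "('a \<Rightarrow> ereal) \<Rightarrow> bool" where
  "proper_fun h \<longleftrightarrow> (\<forall>x. h x \<noteq> -\<infinity>) \<and> effective_domain h \<noteq> {}"

definition epigraph_ereal :: "('a \<Rightarrow> ereal) \<Rightarrow> ('a \<times> real) set" where
  "epigraph_ereal h = {(x, r). h x \<le> ereal r}"

definition closed_fun :: "('a::topological_space \<Rightarrow> ereal) \<Rightarrow> bool" where
  "closed_fun h \<longleftrightarrow> closed (epigraph_ereal h)"

definition convex_fun :: "('a::real_vector \<Rightarrow> ereal) \<Rightarrow> bool" where
  "convex_fun h \<longleftrightarrow> convex (epigraph_ereal h)"

definition subdifferential :: "('a::real_inner \<Rightarrow> ereal) \<Rightarrow> 'a \<Rightarrow> 'a set" where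
  "subdifferential h x =
     {s. h x < \<infinity> \<and> (\<forall>y. h x + ereal (inner s (y - x)) \<le> h y)}"

definition linear_argmin :: "('a::real_inner \<Rightarrow> ereal) \<Rightarrow> 'a \<Rightarrow> 'a set" where
  "linear_argmin h u = {v. is_arg_min (\<lambda>w. ereal (inner u w) + h w) (\<lambda>_. True) v}"

definition pos_part :: "real ^ 'm \<Rightarrow> real ^ 'm" where
  "pos_part a = (\<chi> i. max (a $ i) 0)"

definition objective :: "('a \<Rightarrow> real) \<Rightarrow> ('a \<Rightarrow> ereal) \<Rightarrow> 'a \<Rightarrow> ereal" where
  "objective f h x = ereal (f x) + h x"

definition optimal_value ::
    "('a \<Rightarrow> real) \<Rightarrow> ('a \<Rightarrow> ereal) \<Rightarrow> ('a \<Rightarrow> real ^ 'm) \<Rightarrow> ereal" where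
  "optimal_value f h g = (INF x\<in>{x. \<forall>i. g x $ i \<le> 0}. objective f h x)"

definition KKT_point ::
    "('a::real_inner \<Rightarrow> real) \<Rightarrow> ('a \<Rightarrow> ereal) \<Rightarrow> ('a \<Rightarrow> real ^ 'm) \<Rightarrow> 'a \<Rightarrow> real ^ 'm \<Rightarrow> bool" where
  "KKT_point f h g x z \<longleftrightarrow>
     (\<exists>s\<in>subdifferential h x.
        gradient f x + s + (\<Sum>i\<in>UNIV. (z $ i) *\<^sub>R gradient (\<lambda>y. g y $ i) x) = 0) \<and>
     (\<forall>i. g x $ i \<le> 0) \<and> (\<forall>i. 0 \<le> z $ i) \<and> inner z (g x) = 0"

definition Psi :: "('a \<Rightarrow> real ^ 'm) \<Rightarrow> real \<Rightarrow> 'a \<Rightarrow> real ^ 'm \<Rightarrow> real" where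
  "Psi g lam x z =
     lam / 2 * (\<Sum>i\<in>UNIV. ((max (g x $ i + z $ i / lam) 0)\<^sup>2 - (z $ i / lam)\<^sup>2))"

definition aug_fun ::
    "('a \<Rightarrow> real) \<Rightarrow> ('a \<Rightarrow> real ^ 'm) \<Rightarrow> real \<Rightarrow> 'a \<Rightarrow> real ^ 'm \<Rightarrow> real" where
  "aug_fun f g lam x z = f x + Psi g lam x z"

lemma has_field_derivative_pos_part_sq:
  "((\<lambda>t::real. (max t 0)\<^sup>2) has_field_derivative 2 * max t 0) (at t)"
proof -
  consider "t > 0" | "t < 0" | "t = 0" by linarith
  then show ?thesis
  proof cases
    case 1
    have "((\<lambda>t::real. t\<^sup>2) has_field_derivative 2 * max t 0) (at t)"
      using 1 by (auto intro!: derivative_eq_intros)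
    then show ?thesis
      by (rule has_field_derivative_transform_within_open[of _ _ _ "{0<..}"])
        (use 1 in \<open>simp_all add: max_def\<close>)
  next
    case 2
    have "((\<lambda>t::real. 0) has_field_derivative 2 * max t 0) (at t)"
      using 2 by (simp add: max_def)
    then show ?thesis
      by (rule has_field_derivative_transform_within_open[of _ _ _ "{..<0}"])
        (use 2 in \<open>simp_all add: max_def\<close>)
  next
    case 3
    have bound: "norm ((max y 0)\<^sup>2 / y) \<le> \<bar>y\<bar>" for y :: real
      by (cases "y > 0") (simp_all add: max_def power2_eq_square)
    have lim: "((\<lambda>y::real. \<bar>y\<bar>) \<longlongrightarrow> 0) (at 0)"
      by (rule tendsto_rabs_zero) (rule tendsto_ident_at)
    have "((\<lambda>y::real. (max y 0)\<^sup>2 / y) \<longlongrightarrow> 0) (at 0)"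
      by (rule Lim_null_comparison[OF _ lim]) (intro always_eventually allI bound)
    then show ?thesis using 3 by (simp add: has_field_derivative_iff)
  qed
qed

text \<open>The gradient used in the linear subproblem is that of \<open>aug_fun\<close> in its primal argument; it
  agrees with the usual formula involving the updated multipliers.\<close>

lemma gradient_aug_fun:
  fixes f :: "'a::euclidean_space \<Rightarrow> real" and g :: "'a \<Rightarrow> real ^ 'm"
  assumes "lam > 0" and "f differentiable (at x)"
    and "\<And>i. (\<lambda>y. g y $ i) differentiable (at x)"
  shows "gradient (\<lambda>y. aug_fun f g lam y z) x =
     gradient f x + (\<Sum>i\<in>UNIV. max (lam * g x $ i + z $ i) 0 *\<^sub>R gradient (\<lambda>y. g y $ i) x)"
proof (rule gradient_eqI)
  have lg: "max (lam * g x $ i + z $ i) 0 = lam * max (g x $ i + z $ i / lam) 0" for i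
    using assms(1) by (simp add: max_mult_distrib_left distrib_left)
  have df: "(f has_derivative (\<lambda>h. inner h (gradient f x))) (at x)"
    using GDERIV_gradient[OF assms(2)] by (simp add: gderiv_def)
  have dg: "((\<lambda>y. g y $ i) has_derivative (\<lambda>h. inner h (gradient (\<lambda>y. g y $ i) x))) (at x)" for i
    using GDERIV_gradient[OF assms(3)] by (simp add: gderiv_def)
  have dsq: "((\<lambda>y. (max (g y $ i + z $ i / lam) 0)\<^sup>2) has_derivative
      (\<lambda>h. inner h (gradient (\<lambda>y. g y $ i) x) * (2 * max (g x $ i + z $ i / lam) 0))) (at x)" for i
  proof -
    have "((\<lambda>y. g y $ i + z $ i / lam) has_derivative
        (\<lambda>h. inner h (gradient (\<lambda>y. g y $ i) x))) (at x)"
      using dg[of i] by (auto intro!: derivative_eq_intros)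
    from has_derivative_compose[OF this
        has_field_derivative_pos_part_sq[THEN has_field_derivative_imp_has_derivative]]
    show ?thesis by (simp add: mult.commute)
  qed
  show "GDERIV (\<lambda>y. aug_fun f g lam y z) x :> gradient f x +
      (\<Sum>i\<in>UNIV. max (lam * g x $ i + z $ i) 0 *\<^sub>R gradient (\<lambda>y. g y $ i) x)"
  proof -
    let ?D = "\<lambda>i. gradient (\<lambda>y. g y $ i) x" and ?m = "\<lambda>i. max (g x $ i + z $ i / lam) 0"
    have "((\<lambda>y. \<Sum>i\<in>UNIV. (max (g y $ i + z $ i / lam) 0)\<^sup>2 - (z $ i / lam)\<^sup>2) has_derivative
        (\<lambda>h. \<Sum>i\<in>UNIV. inner h (?D i) * (2 * ?m i) - 0)) (at x)"
      by (intro has_derivative_sum has_derivative_diff dsq has_derivative_const)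
    from has_derivative_add[OF df has_derivative_mult_right[OF this, of "lam / 2"]]
    have "((\<lambda>y. aug_fun f g lam y z) has_derivative (\<lambda>h. inner h (gradient f x) +
        lam / 2 * (\<Sum>i\<in>UNIV. inner h (?D i) * (2 * ?m i) - 0))) (at x)"
      unfolding aug_fun_def Psi_def .
    moreover have "inner h (gradient f x) +
        lam / 2 * (\<Sum>i\<in>UNIV. inner h (?D i) * (2 * ?m i) - 0) =
        inner h (gradient f x + (\<Sum>i\<in>UNIV. (lam * ?m i) *\<^sub>R ?D i))" for h
      by (simp add: inner_add_right inner_sum_right sum_distrib_left mult.commute
          mult.left_commute)
    ultimately show ?thesis unfolding gderiv_def lg by simp
  qed
qed

text \<open>The sequences \<open>lam\<close>, \<open>sig\<close>, \<open>alpha\<close> are the penalty parameters, dual stepsizes and primal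
  stepsizes; \<open>v\<close> collects the (arbitrary) choices of minimizers of the linear subproblems.\<close>

definition single_loop_run ::
    "('a::real_inner \<Rightarrow> real) \<Rightarrow> ('a \<Rightarrow> ereal) \<Rightarrow> ('a \<Rightarrow> real ^ 'm) \<Rightarrow>
     (nat \<Rightarrow> real) \<Rightarrow> (nat \<Rightarrow> real) \<Rightarrow> (nat \<Rightarrow> real) \<Rightarrow>
     (nat \<Rightarrow> 'a) \<Rightarrow> (nat \<Rightarrow> 'a) \<Rightarrow> (nat \<Rightarrow> real ^ 'm) \<Rightarrow> bool" where
  "single_loop_run f h g lam sig alpha v x z \<longleftrightarrow>
     x 0 \<in> effective_domain h \<and> (\<forall>i. 0 \<le> z 0 $ i) \<and>
     (\<forall>k. v k \<in> linear_argmin h (gradient (\<lambda>y. aug_fun f g (lam k) y (z k)) (x k))) \<and>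
     (\<forall>k. x (Suc k) = x k + alpha k *\<^sub>R (v k - x k)) \<and>
     (\<forall>k. z (Suc k) =
        z k + sig k *\<^sub>R (\<chi> i. max (- (z k $ i) / lam k) (g (x (Suc k)) $ i)))"

definition cluster_point :: "(nat \<Rightarrow> 'a::topological_space) \<Rightarrow> 'a \<Rightarrow> bool" where
  "cluster_point s l \<longleftrightarrow> (\<exists>r. strict_mono r \<and> (s \<circ> r) \<longlonglongrightarrow> l)"

end

theory Submission
  imports Defs
begin

text \<open>
  With \<open>m = max(g, - z / lam)\<close> the augmented term is
  \<open>Psi = inner z m + lam / 2 * (norm m)\<^sup>2\<close>, the minimum of
  \<open>inner z s + lam / 2 * (norm s)\<^sup>2\<close> over \<open>s \<ge> g\<close>.  Let \<open>E k\<close> be the excess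
  of \<open>F + h\<close> over the optimal value at step \<open>k\<close>.  Convexity bounds the Frank--Wolfe gap below by
  \<open>E k\<close>, so one primal step contracts the excess by the factor \<open>1 - alpha k\<close> up to
  \<open>O(lam k * (alpha k)\<^sup>2)\<close>.  Changing \<open>lam\<close> and \<open>z\<close> costs at most
  \<open>(sig k + (lam (k+1) - lam k)) * (norm m)\<^sup>2\<close>, and the KKT multiplier gives
  \<open>lam / 4 * (norm m)\<^sup>2 \<le> excess + O(1 / lam)\<close>; this cost is therefore only
  \<open>O(1 / k)\<close> relative to the excess, which the contraction of order \<open>k powr (-p)\<close> absorbs.
  The recurrence yields \<open>E k = O(k powr (-q))\<close> with \<open>q = min (p - tau) tau\<close>, hence the rates.
  Since \<open>\<Sum>k. alpha k\<close> diverges, the gap tends to \<open>0\<close> along a subsequence, and a vanishing gap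
  passes to the limit as the stationarity condition because \<open>h\<close> is closed.
\<close>

section \<open>Convex functions and the augmented term\<close>

text \<open>By convexity the difference quotient along the segment towards \<open>y\<close> is at
  most \<open>f y - f x\<close>, and its right limit at \<open>0\<close> is the directional
  derivative.\<close>

lemma convex_on_gradient_le:
  fixes f :: "'a::euclidean_space \<Rightarrow> real"
  assumes "convex_on UNIV f" and "f differentiable (at x)"
  shows "f x + inner (gradient f x) (y - x) \<le> f y"
proof -
  let ?\<phi> = "\<lambda>t::real. f (x + t *\<^sub>R (y - x))"
  have "(f has_derivative (\<lambda>h. inner h (gradient f x))) (at (x + 0 *\<^sub>R (y - x)))"
    using GDERIV_gradient[OF assms(2)] by (simp add: gderiv_def)
  moreover have "((\<lambda>t::real. x + t *\<^sub>R (y - x)) has_derivative (\<lambda>t. t *\<^sub>R (y - x))) (at 0)"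
    by (auto intro!: derivative_eq_intros)
  ultimately have "(?\<phi> has_derivative (\<lambda>t. inner (t *\<^sub>R (y - x)) (gradient f x))) (at 0)"
    by (rule has_derivative_compose[rotated])
  then have "(?\<phi> has_field_derivative inner (gradient f x) (y - x)) (at 0)"
    by (simp add: has_field_derivative_def inner_commute mult.commute[of _ "inner _ _"])
  then have "((\<lambda>t. (?\<phi> t - ?\<phi> 0) / t) \<longlongrightarrow> inner (gradient f x) (y - x)) (at_right 0)"
    unfolding has_field_derivative_iff by (simp add: filterlim_at_split)
  moreover have "eventually (\<lambda>t. (?\<phi> t - ?\<phi> 0) / t \<le> f y - f x) (at_right 0)"
    unfolding eventually_at_right_field
  proof (intro exI[of _ 1] conjI allI impI)
    fix t :: real assume t: "0 < t" "t < 1"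
    have "x + t *\<^sub>R (y - x) = (1 - t) *\<^sub>R x + t *\<^sub>R y"
      by (simp add: algebra_simps)
    then have "?\<phi> t \<le> (1 - t) * f x + t * f y"
      using convex_onD[OF assms(1), of t x y] t by simp
    then show "(?\<phi> t - ?\<phi> 0) / t \<le> f y - f x"
      using t by (simp add: field_simps)
  qed simp
  ultimately have "inner (gradient f x) (y - x) \<le> f y - f x"
    by (rule tendsto_upperbound) simp
  then show ?thesis by simp
qed

text \<open>Convexity replaces the factor \<open>L / 2\<close> of the usual descent lemma by \<open>L\<close>, which spares an
  integration along the segment.\<close>

lemma convex_on_descent:
  fixes f :: "'a::euclidean_space \<Rightarrow> real"
  assumes "convex_on UNIV f" and "f differentiable (at y)"
    and "L-lipschitz_on S (gradient f)" and "x \<in> S" and "y \<in> S"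
  shows "f y \<le> f x + inner (gradient f x) (y - x) + L * (norm (y - x))\<^sup>2"
proof -
  have "f y \<le> f x + inner (gradient f y) (y - x)"
    using convex_on_gradient_le[OF assms(1,2), of x] by (simp add: inner_diff_right)
  also have "inner (gradient f y) (y - x) =
      inner (gradient f x) (y - x) + inner (gradient f y - gradient f x) (y - x)"
    by (simp add: inner_diff_left)
  also have "inner (gradient f y - gradient f x) (y - x) \<le>
      norm (gradient f y - gradient f x) * norm (y - x)"
    by (rule norm_cauchy_schwarz)
  also have "\<dots> \<le> (L * norm (y - x)) * norm (y - x)"
    using lipschitz_onD[OF assms(3,5,4)] by (intro mult_right_mono) (simp_all add: dist_norm)
  finally show ?thesis by (simp add: power2_eq_square mult.assoc)
qed

section \<open>Tangent and quadratic bounds for the squared positive part\<close>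

text \<open>The map \<open>(max t 0)^2\<close> is convex with slope \<open>2 * max t 0\<close>, so
  this is its tangent inequality; it reduces to the square of \<open>max b 0 - max a 0\<close> being
  nonnegative.\<close>

lemma pos_part_sq_ge:
  "(max a 0)\<^sup>2 + 2 * max a 0 * (b - a) \<le> (max b (0::real))\<^sup>2"
proof -
  have "0 \<le> (max b 0 - max a 0)\<^sup>2" by simp
  moreover have "(max b 0 - max a 0)\<^sup>2 = (max b 0)\<^sup>2 - 2 * (max a 0 * max b 0) + max a 0 * max a 0"
    by (simp add: power2_eq_square algebra_simps)
  moreover have "2 * max a 0 * (b - a) = 2 * (max a 0 * b) - 2 * (max a 0 * a)"
    by (simp add: algebra_simps)
  moreover have "max a 0 * b \<le> max a 0 * max b 0" by (rule mult_left_mono) auto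
  moreover have "max a 0 * a = max a 0 * max a 0" by (simp add: max_def)
  ultimately show ?thesis by (simp add: power2_eq_square[of "max a 0"])
qed

text \<open>Squaring \<open>max b 0 \<le> \<bar>b - a + max a 0\<bar>\<close> gives the matching
  upper bound, with the curvature of \<open>t^2\<close>.\<close>

lemma pos_part_sq_le:
  "(max b 0)\<^sup>2 \<le> (max a 0)\<^sup>2 + 2 * max a 0 * (b - a) + (b - a)\<^sup>2" for a b :: real
proof -
  have "(max b 0)\<^sup>2 \<le> (b - a + max a 0)\<^sup>2"
    by (subst abs_le_square_iff[symmetric]) auto
  then show ?thesis by (simp add: power2_eq_square algebra_simps)
qed

text \<open>Adding \<open>z / lam\<close> to \<open>max c (- z / lam)\<close> gives
  \<open>max (c + z / lam) 0\<close>; expanding the square then cancels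
  \<open>(z / lam)^2\<close>.\<close>

lemma aug_term_eq:
  assumes "lam > (0::real)"
  shows "lam / 2 * ((max (c + z / lam) 0)\<^sup>2 - (z / lam)\<^sup>2) =
    z * max c (- z / lam) + lam / 2 * (max c (- z / lam))\<^sup>2"
proof (cases "c + z / lam \<ge> 0")
  case True
  then have "max c (- z / lam) = c" "max (c + z / lam) 0 = c + z / lam" by auto
  then show ?thesis using assms by (simp only:) (simp add: power2_eq_square field_simps)
next
  case False
  then have "max c (- z / lam) = - z / lam" "max (c + z / lam) 0 = 0" by auto
  then show ?thesis using assms by (simp only:) (simp add: power2_eq_square field_simps)
qed

lemma aug_term_le:
  assumes "lam > (0::real)" and "c \<le> s"
  shows "lam / 2 * ((max (c + z / lam) 0)\<^sup>2 - (z / lam)\<^sup>2) \<le> z * s + lam / 2 * s\<^sup>2"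
proof -
  have "(max (c + z / lam) 0)\<^sup>2 \<le> (s + z / lam)\<^sup>2"
    using assms by (auto simp: max_def intro!: power_mono)
  then have "lam / 2 * ((max (c + z / lam) 0)\<^sup>2 - (z / lam)\<^sup>2) \<le>
      lam / 2 * ((s + z / lam)\<^sup>2 - (z / lam)\<^sup>2)"
    using assms(1) by (intro mult_left_mono) auto
  also have "\<dots> = z * s + lam / 2 * s\<^sup>2"
    using assms(1) by (simp add: power2_eq_square field_simps)
  finally show ?thesis .
qed

text \<open>Translates convexity of the epigraph into real-valued convexity on the effective domain,
  where \<open>h\<close> is finite, so that library facts about \<open>convex_on\<close>
  apply.\<close>

lemma convex_fun_dom:
  fixes h :: "'a::real_vector \<Rightarrow> ereal"
  assumes "convex_fun h" and "proper_fun h"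
  shows "convex_on (effective_domain h) (\<lambda>y. real_of_ereal (h y))"
proof -
  have real: "ereal (real_of_ereal (h y)) = h y" if "y \<in> effective_domain h" for y
    using that assms(2) by (intro ereal_real') (auto simp: effective_domain_def proper_fun_def)
  have comb: "h ((1 - t) *\<^sub>R a + t *\<^sub>R b) \<le>
      ereal ((1 - t) * real_of_ereal (h a) + t * real_of_ereal (h b))"
    if t: "0 \<le> t" "t \<le> 1" and ab: "a \<in> effective_domain h" "b \<in> effective_domain h" for t a b
  proof -
    have "(a, real_of_ereal (h a)) \<in> epigraph_ereal h" "(b, real_of_ereal (h b)) \<in> epigraph_ereal h"
      using real ab by (auto simp: epigraph_ereal_def)
    then have "(1 - t) *\<^sub>R (a, real_of_ereal (h a)) + t *\<^sub>R (b, real_of_ereal (h b)) \<in> epigraph_ereal h"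
      using assms(1) t unfolding convex_fun_def by (intro convexD) auto
    then show ?thesis by (simp add: epigraph_ereal_def)
  qed
  have dom: "(1 - t) *\<^sub>R a + t *\<^sub>R b \<in> effective_domain h"
    if "0 \<le> t" "t \<le> 1" "a \<in> effective_domain h" "b \<in> effective_domain h" for t a b
    using comb[OF that] by (auto simp: effective_domain_def)
  show ?thesis
  proof
    show "convex (effective_domain h)" using dom by (auto simp: convex_alt)
  next
    fix t :: real and a b
    assume *: "t > 0" "t < 1" "a \<in> effective_domain h" "b \<in> effective_domain h"
    then have "ereal (real_of_ereal (h ((1 - t) *\<^sub>R a + t *\<^sub>R b))) \<le>
        ereal ((1 - t) * real_of_ereal (h a) + t * real_of_ereal (h b))"
      using comb[of t a b] by (subst real) (auto intro!: dom)
    then show "real_of_ereal (h ((1 - t) *\<^sub>R a + t *\<^sub>R b)) \<le>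
        (1 - t) * real_of_ereal (h a) + t * real_of_ereal (h b)" by simp
  qed
qed

section \<open>The augmented term as a minimum over slack shifts\<close>

text \<open>One vector with two roles: the direction of the multiplier update, and, for positive
  \<open>lam\<close>, the shift at which the bound \<open>Psi_le\<close> is attained.\<close>

definition dual_step :: "('a \<Rightarrow> real ^ 'm) \<Rightarrow> real \<Rightarrow> 'a \<Rightarrow> real ^ 'm \<Rightarrow> real ^ 'm" where
  "dual_step g lam y z = (\<chi> i. max (g y $ i) (- (z $ i) / lam))"

lemma Psi_eq:
  assumes "lam > 0"
  shows "Psi g lam y z =
    inner z (dual_step g lam y z) + lam / 2 * (norm (dual_step g lam y z))\<^sup>2"
proof -
  have "Psi g lam y z = (\<Sum>i\<in>UNIV. z $ i * dual_step g lam y z $ i +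
      lam / 2 * (dual_step g lam y z $ i)\<^sup>2)"
    unfolding Psi_def sum_distrib_left dual_step_def
    by (intro sum.cong refl) (simp only: vec_lambda_beta aug_term_eq[OF assms])
  also have "\<dots> = inner z (dual_step g lam y z) + lam / 2 * (norm (dual_step g lam y z))\<^sup>2"
    unfolding power2_norm_eq_inner inner_vec_def
    by (simp add: sum.distrib sum_distrib_left power2_eq_square)
  finally show ?thesis .
qed

text \<open>The augmented Lagrangian term is a minimum over slack shifts \<open>s \<ge> g y\<close>; an arbitrary feasible
  shift therefore bounds it from above, with no differentiation in \<open>lam\<close> or \<open>z\<close>.\<close>

lemma Psi_le:
  assumes "lam > 0" and "\<And>i. g y $ i \<le> s $ i"
  shows "Psi g lam y z \<le> inner z s + lam / 2 * (norm s)\<^sup>2"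
proof -
  have "Psi g lam y z \<le> (\<Sum>i\<in>UNIV. z $ i * s $ i + lam / 2 * (s $ i)\<^sup>2)"
    unfolding Psi_def sum_distrib_left by (intro sum_mono aug_term_le assms)
  also have "\<dots> = inner z s + lam / 2 * (norm s)\<^sup>2"
    unfolding power2_norm_eq_inner inner_vec_def
    by (simp add: sum.distrib sum_distrib_left power2_eq_square)
  finally show ?thesis .
qed

lemma pos_part_shift:
  assumes "lam > (0::real)"
  shows "max (lam * c + z) 0 = lam * max (c + z / lam) 0"
  using assms by (simp add: max_mult_distrib_left distrib_left)

text \<open>\<open>Psi\<close> is convex as a function of the constraint values, and its slopes
  there are the updated multipliers \<open>max (lam * g y $ i + z $ i) 0\<close>.\<close>

lemma Psi_ge_linear:
  assumes "lam > 0"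
  shows "Psi g lam y z + (\<Sum>i\<in>UNIV. max (lam * g y $ i + z $ i) 0 * (g y' $ i - g y $ i)) \<le>
    Psi g lam y' z"
proof -
  have "lam / 2 * ((max (g y $ i + z $ i / lam) 0)\<^sup>2 - (z $ i / lam)\<^sup>2) +
      max (lam * g y $ i + z $ i) 0 * (g y' $ i - g y $ i) \<le>
      lam / 2 * ((max (g y' $ i + z $ i / lam) 0)\<^sup>2 - (z $ i / lam)\<^sup>2)" for i
    using mult_left_mono[OF pos_part_sq_ge[of "g y $ i + z $ i / lam" "g y' $ i + z $ i / lam"],
        of "lam / 2"] assms
    unfolding pos_part_shift[OF assms] by (simp add: algebra_simps)
  then show ?thesis
    unfolding Psi_def sum_distrib_left sum.distrib[symmetric] by (intro sum_mono)
qed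

text \<open>As a function of the constraint values \<open>Psi\<close> has curvature at most
  \<open>lam\<close>; this is where the penalty parameter enters the error of a primal step.\<close>

lemma Psi_le_quadratic:
  assumes "lam > 0"
  shows "Psi g lam y' z \<le> Psi g lam y z +
    (\<Sum>i\<in>UNIV. max (lam * g y $ i + z $ i) 0 * (g y' $ i - g y $ i) + lam / 2 * (g y' $ i - g y $ i)\<^sup>2)"
proof -
  have "lam / 2 * ((max (g y' $ i + z $ i / lam) 0)\<^sup>2 - (z $ i / lam)\<^sup>2) \<le>
      lam / 2 * ((max (g y $ i + z $ i / lam) 0)\<^sup>2 - (z $ i / lam)\<^sup>2) +
      (max (lam * g y $ i + z $ i) 0 * (g y' $ i - g y $ i) + lam / 2 * (g y' $ i - g y $ i)\<^sup>2)" for i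
    using mult_left_mono[OF pos_part_sq_le[of "g y' $ i + z $ i / lam" "g y $ i + z $ i / lam"],
        of "lam / 2"] assms
    unfolding pos_part_shift[OF assms] by (simp add: algebra_simps)
  then show ?thesis
    unfolding Psi_def sum_distrib_left sum.distrib[symmetric] by (intro sum_mono)
qed

section \<open>One step of the algorithm\<close>

text \<open>Collects the estimates for a single step, before any polynomial rates are imposed on the
  parameters; a KKT pair is fixed as the reference point.\<close>

locale single_loop =
  fixes f :: "'a::euclidean_space \<Rightarrow> real" and h :: "'a \<Rightarrow> ereal" and g :: "'a \<Rightarrow> real ^ 'm"
    and Lf D :: real and Lg :: "'m \<Rightarrow> real" and xstar :: 'a and zstar :: "real ^ 'm"
    and lam sig alpha :: "nat \<Rightarrow> real" and v x :: "nat \<Rightarrow> 'a" and z :: "nat \<Rightarrow> real ^ 'm"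
  assumes f_convex: "convex_on UNIV f"
    and f_diff: "\<And>y. f differentiable (at y)"
    and f_smooth: "Lf-lipschitz_on UNIV (gradient f)"
    and h_proper: "proper_fun h"
    and h_closed: "closed_fun h"
    and h_convex: "convex_fun h"
    and dom_diam: "\<And>y y'. y \<in> effective_domain h \<Longrightarrow> y' \<in> effective_domain h \<Longrightarrow> norm (y - y') \<le> D"
    and g_convex: "\<And>i. convex_on UNIV (\<lambda>y. g y $ i)"
    and g_diff: "\<And>i y. (\<lambda>y. g y $ i) differentiable (at y)"
    and g_smooth: "\<And>i. (Lg i)-lipschitz_on (effective_domain h) (gradient (\<lambda>y. g y $ i))"
    and KKT_star: "KKT_point f h g xstar zstar"
    and lam_pos: "\<And>k. lam k > 0"
    and lam_mono: "mono lam"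
    and alpha_range: "\<And>k. 0 \<le> alpha k \<and> alpha k \<le> 1"
    and sig_nonneg: "\<And>k. sig k \<ge> 0"
    and sig_le: "\<And>k. sig k \<le> lam k"
    and sig_summable: "summable sig"
    and run: "single_loop_run f h g lam sig alpha v x z"
begin

abbreviation "S \<equiv> effective_domain h"
abbreviation "H \<equiv> \<lambda>y. real_of_ereal (h y)"
abbreviation "Dg \<equiv> \<lambda>i. gradient (\<lambda>y. g y $ i)"
abbreviation "Lstar \<equiv> f xstar + H xstar"

text \<open>Penalty, point and multiplier are separate arguments because the value is also needed
  halfway through an iteration, at \<open>lam k\<close>, \<open>x (Suc k)\<close>,
  \<open>z k\<close>. It can be negative; \<open>excess_lower\<close> limits by how much.\<close>

definition "excess l y w = aug_fun f g l y w + H y - Lstar"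
definition "lag_grad w y = gradient f y + (\<Sum>i\<in>UNIV. (w $ i) *\<^sub>R Dg i y)"
definition "multiplier k = pos_part (lam k *\<^sub>R g (x k) + z k)"
text \<open>The Frank--Wolfe gap of the augmented problem at \<open>x k\<close>: the decrease of its
  model, linear in the smooth part, achieved by \<open>v k\<close>.\<close>

definition "gap k = inner (lag_grad (multiplier k) (x k)) (x k - v k) + H (x k) - H (v k)"

section \<open>Well-definedness of the iterates and the linear subproblem\<close>

lemma dom_real:
  assumes "y \<in> S"
  obtains r where "h y = ereal r"
  using assms h_proper by (cases "h y") (auto simp: effective_domain_def proper_fun_def)

lemma H_le:
  assumes "ereal a + h y \<le> ereal b + h y'" and "y \<in> S" and "y' \<in> S"
  shows "a + H y \<le> b + H y'"
proof -
  obtain r r' where "h y = ereal r" "h y' = ereal r'" using assms(2,3) by (metis dom_real)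
  then show ?thesis using assms(1) by simp
qed

lemma H_convex: "convex_on S H"
  using h_convex h_proper by (rule convex_fun_dom)

lemma z_eq: "z (Suc k) = z k + sig k *\<^sub>R dual_step g (lam k) (x (Suc k)) (z k)"
  using run by (simp add: single_loop_run_def dual_step_def max.commute)

lemma x_eq: "x (Suc k) = x k + alpha k *\<^sub>R (v k - x k)"
  using run by (simp add: single_loop_run_def)

lemma xstar_dom: "xstar \<in> S"
  using KKT_star by (auto simp: KKT_point_def subdifferential_def effective_domain_def)

lemma grad_eq: "gradient (\<lambda>y. aug_fun f g (lam k) y (z k)) (x k) = lag_grad (multiplier k) (x k)"
  by (subst gradient_aug_fun[OF lam_pos f_diff g_diff]) (simp add: lag_grad_def multiplier_def pos_part_def)

lemma v_min: "ereal (inner (lag_grad (multiplier k) (x k)) (v k)) + h (v k) \<le>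
    ereal (inner (lag_grad (multiplier k) (x k)) y) + h y"
  using run unfolding single_loop_run_def linear_argmin_def is_arg_min_def
  by (auto simp: grad_eq not_less)

lemma v_dom: "v k \<in> S"
proof -
  obtain r where "h xstar = ereal r" using xstar_dom by (rule dom_real)
  then show ?thesis using v_min[of k xstar] by (auto simp: effective_domain_def)
qed

lemma x_dom: "x k \<in> S"
proof (induction k)
  case 0
  show ?case using run by (simp add: single_loop_run_def)
next
  case (Suc k)
  have "x (Suc k) = (1 - alpha k) *\<^sub>R x k + alpha k *\<^sub>R v k"
    by (simp add: x_eq algebra_simps)
  then show ?case
    using convex_on_imp_convex[OF H_convex] Suc v_dom[of k] alpha_range[of k] by (auto simp: convex_alt)
qed

text \<open>Since \<open>v k\<close> minimizes the linear model, the gap dominates the model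
  decrease towards every point of the domain. Applied to \<open>xstar\<close> this gives the
  contraction, and in the limit it gives stationarity.\<close>

lemma gap_ge:
  assumes "y \<in> S"
  shows "inner (lag_grad (multiplier k) (x k)) (x k - y) + H (x k) - H y \<le> gap k"
proof -
  have "inner (lag_grad (multiplier k) (x k)) (v k) + H (v k) \<le>
      inner (lag_grad (multiplier k) (x k)) y + H y"
    using v_min v_dom assms by (rule H_le)
  then show ?thesis by (simp add: gap_def inner_diff_right)
qed

lemma gap_nonneg: "0 \<le> gap k"
  using gap_ge[OF x_dom, of k k] by simp

lemma dual_step_le:
  assumes "0 \<le> w $ i" and "l > 0"
  shows "dual_step g l y w $ i \<le> max (g y $ i) 0"
proof -
  have "- (w $ i) / l \<le> 0" using assms by simp
  then show ?thesis unfolding dual_step_def by simp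
qed

text \<open>The clamp at \<open>- z / lam\<close> lets a step reduce a coordinate at most to
  \<open>(1 - sig k / lam k)\<close> times its value, and \<open>sig k \<le> lam k\<close> keeps
  this factor nonnegative.\<close>

lemma z_nonneg: "0 \<le> z k $ i"
proof (induction k arbitrary: i)
  case 0
  show ?case using run by (simp add: single_loop_run_def)
next
  case (Suc k)
  have "sig k * (z k $ i / lam k) \<le> lam k * (z k $ i / lam k)"
    using Suc[of i] lam_pos[of k] sig_le[of k] by (intro mult_right_mono) (auto intro!: divide_nonneg_pos)
  moreover have "sig k * (- (z k $ i) / lam k) \<le> sig k * dual_step g (lam k) (x (Suc k)) (z k) $ i"
    using sig_nonneg[of k] by (intro mult_left_mono) (auto simp: dual_step_def)
  ultimately show ?case using lam_pos[of k] by (simp add: z_eq)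
qed

section \<open>Uniform bounds on the constraints and the multipliers\<close>

lemma g_tangent: "g y $ i + inner (Dg i y) (y' - y) \<le> g y' $ i"
  using convex_on_gradient_le[OF g_convex g_diff] .

text \<open>Lipschitz gradients deviate from their value at \<open>xstar\<close> by at most
  \<open>Lg i * D\<close>; summing the nonnegative bounds over \<open>i\<close> yields one constant
  for all constraints.\<close>

lemma Dg_bounded: "\<exists>M\<ge>0. \<forall>y\<in>S. \<forall>i. norm (Dg i y) \<le> M"
proof -
  have Lg0: "Lg i \<ge> 0" for i using g_smooth[of i] by (rule lipschitz_on_nonneg)
  have D0: "D \<ge> 0" using dom_diam[OF xstar_dom xstar_dom] by simp
  define c where "c i = norm (Dg i xstar) + Lg i * D" for i
  have c0: "c i \<ge> 0" for i using Lg0 D0 by (simp add: c_def)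
  have "norm (Dg i y) \<le> sum c UNIV" if "y \<in> S" for y i
  proof -
    have "norm (Dg i y) \<le> norm (Dg i xstar) + norm (Dg i y - Dg i xstar)"
      using norm_triangle_ineq[of "Dg i xstar" "Dg i y - Dg i xstar"] by simp
    also have "norm (Dg i y - Dg i xstar) \<le> Lg i * norm (y - xstar)"
      using lipschitz_onD[OF g_smooth that xstar_dom] by (simp add: dist_norm)
    also have "\<dots> \<le> Lg i * D" using dom_diam[OF that xstar_dom] Lg0 by (rule mult_left_mono)
    finally have "norm (Dg i y) \<le> c i" by (simp add: c_def)
    also have "c i \<le> sum c UNIV" using c0 by (intro member_le_sum) auto
    finally show ?thesis .
  qed
  then show ?thesis using c0 by (intro exI[of _ "sum c UNIV"] conjI sum_nonneg) auto
qed

text \<open>The tangent inequalities at the two end points bound the difference from both sides, in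
  place of a mean value argument.\<close>

lemma g_lipschitz:
  assumes M: "\<And>y i. y \<in> S \<Longrightarrow> norm (Dg i y) \<le> M" and "y \<in> S" "y' \<in> S"
  shows "\<bar>g y $ i - g y' $ i\<bar> \<le> M * norm (y - y')"
proof -
  have *: "g b $ i - g a $ i \<le> M * norm (b - a)" if "b \<in> S" for a b
  proof -
    have "g b $ i - g a $ i \<le> inner (Dg i b) (b - a)"
      using g_tangent[of b i a] by (simp add: inner_diff_right)
    also have "\<dots> \<le> norm (Dg i b) * norm (b - a)" by (rule norm_cauchy_schwarz)
    also have "\<dots> \<le> M * norm (b - a)" using M[OF that] by (intro mult_right_mono) auto
    finally show ?thesis .
  qed
  show ?thesis using *[OF assms(2), of y'] *[OF assms(3), of y] by (simp add: norm_minus_commute abs_le_iff)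
qed

lemma g_bounded: "\<exists>G\<ge>0. \<forall>y\<in>S. \<forall>i. \<bar>g y $ i\<bar> \<le> G"
proof -
  obtain M where M: "M \<ge> 0" "\<And>y i. y \<in> S \<Longrightarrow> norm (Dg i y) \<le> M" using Dg_bounded by blast
  have D0: "D \<ge> 0" using dom_diam[OF xstar_dom xstar_dom] by simp
  have "\<bar>g y $ i\<bar> \<le> norm (g xstar) + M * D" if "y \<in> S" for y i
  proof -
    have "\<bar>g y $ i\<bar> \<le> \<bar>g xstar $ i\<bar> + \<bar>g y $ i - g xstar $ i\<bar>" by simp
    also have "\<bar>g xstar $ i\<bar> \<le> norm (g xstar)" by (rule component_le_norm_cart)
    also have "\<bar>g y $ i - g xstar $ i\<bar> \<le> M * norm (y - xstar)"
      using M(2) that xstar_dom by (intro g_lipschitz) auto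
    also have "\<dots> \<le> M * D" using dom_diam[OF that xstar_dom] M(1) by (rule mult_left_mono)
    finally show ?thesis by simp
  qed
  then show ?thesis using M(1) D0
    by (intro exI[of _ "norm (g xstar) + M * D"]) auto
qed

text \<open>A step raises each coordinate by at most \<open>sig k * G\<close>, and
  \<open>sig\<close> is summable.\<close>

lemma z_bounded: "\<exists>B\<ge>0. \<forall>k. norm (z k) \<le> B"
proof -
  obtain G where G: "G \<ge> 0" "\<And>y i. y \<in> S \<Longrightarrow> \<bar>g y $ i\<bar> \<le> G" using g_bounded by blast
  have zk: "z k $ i \<le> z 0 $ i + G * (\<Sum>j<k. sig j)" for k i
  proof (induction k)
    case (Suc k)
    have "dual_step g (lam k) (x (Suc k)) (z k) $ i \<le> max (g (x (Suc k)) $ i) 0"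
      using z_nonneg lam_pos by (rule dual_step_le)
    also have "\<dots> \<le> G" using G(2)[OF x_dom, of "Suc k" i] G(1) by auto
    finally have "sig k * dual_step g (lam k) (x (Suc k)) (z k) $ i \<le> sig k * G"
      using sig_nonneg by (rule mult_left_mono)
    then show ?case using Suc by (simp add: z_eq algebra_simps)
  qed simp
  have "norm (z k) \<le> (\<Sum>i\<in>UNIV. z 0 $ i + G * suminf sig)" for k
  proof -
    have "norm (z k) \<le> (\<Sum>i\<in>UNIV. \<bar>z k $ i\<bar>)" by (rule norm_le_l1_cart)
    also have "\<dots> \<le> (\<Sum>i\<in>UNIV. z 0 $ i + G * suminf sig)"
    proof (rule sum_mono)
      fix i
      have "(\<Sum>j<k. sig j) \<le> suminf sig"
        using sig_summable sig_nonneg by (intro sum_le_suminf) auto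
      then have "G * (\<Sum>j<k. sig j) \<le> G * suminf sig" using G(1) by (rule mult_left_mono)
      then show "\<bar>z k $ i\<bar> \<le> z 0 $ i + G * suminf sig" using zk[of k i] z_nonneg[of k i] by simp
    qed
    finally show ?thesis .
  qed
  then show ?thesis by (meson norm_ge_zero order_trans)
qed

section \<open>Lower bounds from the KKT multiplier\<close>

text \<open>The point \<open>xstar\<close> minimizes the Lagrangian at \<open>zstar\<close>: in the
  sum of the subgradient inequality for \<open>h\<close> and the tangent inequalities for
  \<open>f\<close> and the weighted constraints, stationarity cancels all linear terms and
  complementarity removes the constant.\<close>

lemma lagrangian_ge:
  assumes "y \<in> S"
  shows "Lstar \<le> f y + H y + inner zstar (g y)"
proof -
  obtain s where s: "s \<in> subdifferential h xstar"
      "gradient f xstar + s + (\<Sum>i\<in>UNIV. (zstar $ i) *\<^sub>R Dg i xstar) = 0"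
    and kkt: "\<And>i. 0 \<le> zstar $ i" "inner zstar (g xstar) = 0"
    using KKT_star by (auto simp: KKT_point_def)
  let ?d = "y - xstar"
  have "ereal (inner s ?d) + h xstar \<le> ereal 0 + h y"
    using s(1) by (auto simp: subdifferential_def add.commute)
  then have "inner s ?d + H xstar \<le> 0 + H y"
    using xstar_dom assms by (rule H_le)
  moreover have "f xstar + inner (gradient f xstar) ?d \<le> f y"
    using f_convex f_diff by (rule convex_on_gradient_le)
  moreover have "(\<Sum>i\<in>UNIV. zstar $ i * (g xstar $ i + inner (Dg i xstar) ?d)) \<le> inner zstar (g y)"
    unfolding inner_vec_def inner_real_def
    using g_tangent kkt(1) by (intro sum_mono mult_left_mono) auto
  moreover have "(\<Sum>i\<in>UNIV. zstar $ i * (g xstar $ i + inner (Dg i xstar) ?d)) =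
      inner zstar (g xstar) + inner (\<Sum>i\<in>UNIV. (zstar $ i) *\<^sub>R Dg i xstar) ?d"
    by (simp add: inner_vec_def[of zstar] inner_sum_left distrib_left sum.distrib)
  moreover have "inner (gradient f xstar) ?d + inner s ?d +
      inner (\<Sum>i\<in>UNIV. (zstar $ i) *\<^sub>R Dg i xstar) ?d = 0"
    using s(2) by (simp only: inner_add_left[symmetric]) simp
  ultimately show ?thesis using kkt(2) by simp
qed

lemma zstar_nonneg: "0 \<le> zstar $ i"
  using KKT_star by (auto simp: KKT_point_def)

text \<open>Allows any upper bound \<open>s\<close> of the constraints to control the multiplier
  term; the choices used are the dual step, the positive part of \<open>g\<close>, and
  \<open>0\<close> at feasible points.\<close>

lemma inner_zstar_le:
  assumes "\<And>i. g y $ i \<le> s $ i"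
  shows "inner zstar (g y) \<le> norm zstar * norm s"
proof -
  have "inner zstar (g y) \<le> inner zstar s"
    unfolding inner_vec_def using assms zstar_nonneg by (auto intro!: sum_mono mult_left_mono)
  then show ?thesis using norm_cauchy_schwarz[of zstar s] by simp
qed

lemma optimal_value_eq: "optimal_value f h g = ereal Lstar"
proof (rule antisym)
  show "optimal_value f h g \<le> ereal Lstar"
    unfolding optimal_value_def
  proof (rule INF_lower2[of xstar])
    show "objective f h xstar \<le> ereal Lstar"
      by (rule dom_real[OF xstar_dom]) (simp add: objective_def)
  qed (use KKT_star in \<open>auto simp: KKT_point_def\<close>)
  show "ereal Lstar \<le> optimal_value f h g"
    unfolding optimal_value_def
  proof (rule INF_greatest)
    fix y assume y: "y \<in> {x. \<forall>i. g x $ i \<le> 0}"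
    show "ereal Lstar \<le> objective f h y"
    proof (cases "y \<in> S")
      case True
      have "inner zstar (g y) \<le> norm zstar * norm (0 :: real ^ 'm)"
        using y by (intro inner_zstar_le) auto
      then show ?thesis using lagrangian_ge[OF True]
        by (rule_tac dom_real[OF True]) (simp add: objective_def)
    next
      case False
      then show ?thesis by (simp add: objective_def effective_domain_def)
    qed
  qed
qed

text \<open>The Lagrangian bound and \<open>norm w \<le> B\<close> leave a quadratic in the norm of
  the dual step minus a linear term. Half of the quadratic absorbs the linear term at a cost of
  order \<open>1 / l\<close>.\<close>

lemma excess_lower:
  assumes "y \<in> S" and "l > 0" and "norm w \<le> B"
  shows "l / 4 * (norm (dual_step g l y w))\<^sup>2 \<le> excess l y w + (norm zstar + B)\<^sup>2 / l"
proof -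
  let ?m = "dual_step g l y w" and ?C = "norm zstar + B"
  have "inner zstar (g y) \<le> norm zstar * norm ?m"
    by (rule inner_zstar_le) (simp add: dual_step_def)
  moreover have "- (B * norm ?m) \<le> inner w ?m"
    using Cauchy_Schwarz_ineq2[of w ?m] mult_right_mono[OF assms(3), of "norm ?m"] by simp
  ultimately have "l / 2 * (norm ?m)\<^sup>2 - ?C * norm ?m \<le> excess l y w"
    using lagrangian_ge[OF assms(1)]
    by (simp add: excess_def aug_fun_def Psi_eq[OF assms(2)] algebra_simps)
  \<comment> \<open>Completing the square, weighted so that exactly \<open>l / 4\<close> of the
    available \<open>l / 2\<close> is spent.\<close>
  moreover have "0 \<le> (l * norm ?m / 2 - ?C)\<^sup>2 / l" using assms(2) by simp
  then have "?C * norm ?m \<le> l / 4 * (norm ?m)\<^sup>2 + ?C\<^sup>2 / l"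
    using assms(2) by (simp add: power2_eq_square field_simps)
  moreover have "a / 4 * b \<le> e + d" if "a / 2 * b - c \<le> e" "c \<le> a / 4 * b + d" for a b c d e :: real
    using that by simp
  ultimately show ?thesis by blast
qed

section \<open>Effect of a primal step and of a parameter update\<close>

text \<open>Linearizing the augmented objective at \<open>x k\<close> underestimates its value at
  \<open>xstar\<close>, which is at most \<open>Lstar\<close>, while the gap bounds the decrease of
  the linearization.\<close>

lemma excess_le_gap: "excess (lam k) (x k) (z k) \<le> gap k"
proof -
  let ?G = "lag_grad (multiplier k) (x k)" and ?d = "xstar - x k"
  have "f (x k) + inner (gradient f (x k)) ?d \<le> f xstar"
    using f_convex f_diff by (rule convex_on_gradient_le)
  \<comment> \<open>Feasibility of \<open>xstar\<close> makes the zero shift admissible, so the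
    augmented term is nonpositive there.\<close>
  moreover have "Psi g (lam k) xstar (z k) \<le> inner (z k) 0 + lam k / 2 * (norm (0 :: real ^ 'm))\<^sup>2"
    by (rule Psi_le[OF lam_pos]) (use KKT_star in \<open>auto simp: KKT_point_def\<close>)
  moreover have "Psi g (lam k) (x k) (z k) +
      (\<Sum>i\<in>UNIV. multiplier k $ i * (g xstar $ i - g (x k) $ i)) \<le> Psi g (lam k) xstar (z k)"
    using Psi_ge_linear[OF lam_pos] by (simp add: multiplier_def pos_part_def)
  moreover have "inner (\<Sum>i\<in>UNIV. (multiplier k $ i) *\<^sub>R Dg i (x k)) ?d \<le>
      (\<Sum>i\<in>UNIV. multiplier k $ i * (g xstar $ i - g (x k) $ i))"
    unfolding inner_sum_left inner_scaleR_left
  proof (intro sum_mono mult_left_mono)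
    fix i
    show "inner (Dg i (x k)) ?d \<le> g xstar $ i - g (x k) $ i"
      using g_tangent[of "x k" i xstar] by simp
  qed (simp add: multiplier_def pos_part_def)
  moreover have "inner ?G ?d = inner (gradient f (x k)) ?d + inner (\<Sum>i\<in>UNIV. (multiplier k $ i) *\<^sub>R Dg i (x k)) ?d"
    by (simp add: lag_grad_def inner_add_left)
  moreover have "inner ?G (x k - xstar) = - inner ?G ?d" by (simp add: inner_diff_right)
  ultimately show ?thesis
    using gap_ge[OF xstar_dom, of k] by (simp add: excess_def aug_fun_def)
qed

text \<open>A Frank--Wolfe descent inequality. The updated multipliers are \<open>O(lam k)\<close>,
  hence so is the smoothness constant of the augmented objective, and the step length is at most
  \<open>alpha k * D\<close>.\<close>

lemma excess_descent:
  "\<exists>C\<ge>0. \<forall>k. excess (lam k) (x (Suc k)) (z k) \<le>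
     excess (lam k) (x k) (z k) - alpha k * gap k + C * lam k * (alpha k)\<^sup>2"
proof -
  obtain M where M: "M \<ge> 0" "\<And>y i. y \<in> S \<Longrightarrow> norm (Dg i y) \<le> M" using Dg_bounded by blast
  obtain G where G: "G \<ge> 0" "\<And>y i. y \<in> S \<Longrightarrow> \<bar>g y $ i\<bar> \<le> G" using g_bounded by blast
  obtain B where B: "B \<ge> 0" "\<And>k. norm (z k) \<le> B" using z_bounded by blast
  have Lg0: "Lg i \<ge> 0" for i using g_smooth[of i] by (rule lipschitz_on_nonneg)
  have Lf0: "Lf \<ge> 0" using f_smooth by (rule lipschitz_on_nonneg)
  have l0: "lam 0 > 0" by (rule lam_pos)
  \<comment> \<open>Dividing by \<open>lam 0\<close> makes every constant a multiple of
    \<open>lam k\<close>, because \<open>lam 0 \<le> lam k\<close>. In \<open>C2\<close> the first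
    summand is the multiplier bound times the curvature of \<open>g\<close>, the second comes from
    the quadratic part of \<open>Psi_le_quadratic\<close>.\<close>
  define C1 where "C1 = Lf / lam 0"
  define C2 where "C2 i = (G + B / lam 0) * Lg i + M\<^sup>2 / 2" for i
  define C where "C = (C1 + (\<Sum>i\<in>UNIV. C2 i)) * D\<^sup>2"
  have C10: "C1 \<ge> 0" using Lf0 l0 by (simp add: C1_def)
  have C20: "C2 i \<ge> 0" for i using G(1) B(1) Lg0 l0 by (auto simp: C2_def intro!: add_nonneg_nonneg mult_nonneg_nonneg)
  have "excess (lam k) (x (Suc k)) (z k) \<le>
     excess (lam k) (x k) (z k) - alpha k * gap k + C * lam k * (alpha k)\<^sup>2" for k
  proof -
    let ?x = "x k" and ?y = "x (Suc k)" and ?l = "lam k" and ?a = "alpha k" and ?w = "multiplier k"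
    have l: "lam 0 \<le> ?l" using lam_mono by (simp add: monoD)
    have d: "?y - ?x = ?a *\<^sub>R (v k - ?x)" by (simp add: x_eq)
    define n where "n = norm (?y - ?x)"
    have w: "0 \<le> ?w $ i" "?w $ i \<le> ?l * (G + B / lam 0)" for i
    proof -
      show "0 \<le> ?w $ i" by (simp add: multiplier_def pos_part_def)
      have "?l * g ?x $ i \<le> ?l * G" using G(2)[OF x_dom, of k i] lam_pos[of k] by (intro mult_left_mono) auto
      moreover have "z k $ i \<le> B" using component_le_norm_cart[of "z k" i] B(2)[of k] by linarith
      moreover have "B \<le> ?l * (B / lam 0)"
        using mult_right_mono[OF l, of "B / lam 0"] B(1) l0 by simp
      moreover have "0 \<le> ?l * G" "0 \<le> ?l * (B / lam 0)" using G(1) B(1) l0 lam_pos[of k] by auto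
      ultimately show "?w $ i \<le> ?l * (G + B / lam 0)"
        by (simp add: multiplier_def pos_part_def distrib_left)
    qed
    have "f ?y \<le> f ?x + inner (gradient f ?x) (?y - ?x) + Lf * n\<^sup>2"
      unfolding n_def by (rule convex_on_descent[OF f_convex f_diff f_smooth]) auto
    moreover have "Lf * n\<^sup>2 \<le> ?l * C1 * n\<^sup>2"
      using mult_right_mono[OF l C10] l0 by (intro mult_right_mono) (auto simp: C1_def)
    ultimately have f: "f ?y \<le> f ?x + inner (gradient f ?x) (?y - ?x) + ?l * C1 * n\<^sup>2" by simp
    have gi: "?w $ i * (g ?y $ i - g ?x $ i) + ?l / 2 * (g ?y $ i - g ?x $ i)\<^sup>2 \<le>
        ?w $ i * inner (Dg i ?x) (?y - ?x) + ?l * C2 i * n\<^sup>2" for i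
    proof -
      have "g ?y $ i - g ?x $ i \<le> inner (Dg i ?x) (?y - ?x) + Lg i * n\<^sup>2"
        using convex_on_descent[OF g_convex g_diff g_smooth x_dom x_dom] unfolding n_def by (simp add: diff_le_eq add_ac)
      then have "?w $ i * (g ?y $ i - g ?x $ i) \<le> ?w $ i * (inner (Dg i ?x) (?y - ?x) + Lg i * n\<^sup>2)"
        using w(1) by (rule mult_left_mono)
      moreover have "?w $ i * (Lg i * n\<^sup>2) \<le> ?l * (G + B / lam 0) * (Lg i * n\<^sup>2)"
        using w(2) Lg0 by (intro mult_right_mono) auto
      moreover have "(g ?y $ i - g ?x $ i)\<^sup>2 \<le> (M * n)\<^sup>2"
        using g_lipschitz[OF M(2) x_dom x_dom] unfolding n_def by (intro power2_le_iff_abs_le[THEN iffD2]) (auto simp: M(1))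
      then have "?l / 2 * (g ?y $ i - g ?x $ i)\<^sup>2 \<le> ?l / 2 * (M * n)\<^sup>2"
        using lam_pos[of k] by (intro mult_left_mono) auto
      ultimately show ?thesis by (simp add: C2_def algebra_simps power_mult_distrib)
    qed
    have "Psi g ?l ?y (z k) \<le> Psi g ?l ?x (z k) +
        (\<Sum>i\<in>UNIV. ?w $ i * (g ?y $ i - g ?x $ i) + ?l / 2 * (g ?y $ i - g ?x $ i)\<^sup>2)"
      using Psi_le_quadratic[OF lam_pos] by (simp add: multiplier_def pos_part_def)
    also have "\<dots> \<le> Psi g ?l ?x (z k) +
        (\<Sum>i\<in>UNIV. ?w $ i * inner (Dg i ?x) (?y - ?x) + ?l * C2 i * n\<^sup>2)"
      using gi by (intro add_left_mono sum_mono)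
    also have "\<dots> = Psi g ?l ?x (z k) + inner (\<Sum>i\<in>UNIV. (?w $ i) *\<^sub>R Dg i ?x) (?y - ?x) +
        ?l * (\<Sum>i\<in>UNIV. C2 i) * n\<^sup>2"
      by (simp add: sum.distrib inner_sum_left sum_distrib_left sum_distrib_right)
    finally have "aug_fun f g ?l ?y (z k) \<le> aug_fun f g ?l ?x (z k) +
        inner (lag_grad ?w ?x) (?y - ?x) + ?l * (C1 + (\<Sum>i\<in>UNIV. C2 i)) * n\<^sup>2"
      using f by (simp add: aug_fun_def lag_grad_def inner_add_left algebra_simps)
    moreover have "?l * (C1 + (\<Sum>i\<in>UNIV. C2 i)) * n\<^sup>2 \<le> ?l * (C1 + (\<Sum>i\<in>UNIV. C2 i)) * (?a\<^sup>2 * D\<^sup>2)"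
    proof (intro mult_left_mono)
      have "n \<le> ?a * D"
        using dom_diam[OF v_dom x_dom] alpha_range[of k] by (auto simp: n_def d intro!: mult_left_mono)
      then show "n\<^sup>2 \<le> ?a\<^sup>2 * D\<^sup>2"
        unfolding power_mult_distrib[symmetric] by (intro power_mono) (auto simp: n_def)
      show "0 \<le> ?l * (C1 + (\<Sum>i\<in>UNIV. C2 i))"
        using lam_pos[of k] C10 C20 by (intro mult_nonneg_nonneg add_nonneg_nonneg sum_nonneg) auto
    qed
    moreover have "H ?y \<le> (1 - ?a) * H ?x + ?a * H (v k)"
    proof -
      have "?y = (1 - ?a) *\<^sub>R ?x + ?a *\<^sub>R v k" by (simp add: x_eq algebra_simps)
      then show ?thesis
        using convex_onD[OF H_convex, of ?a ?x "v k"] alpha_range[of k] x_dom v_dom by auto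
    qed
    moreover have "inner (lag_grad ?w ?x) (?y - ?x) = - (?a * inner (lag_grad ?w ?x) (?x - v k))"
      unfolding d by (simp add: inner_diff_right algebra_simps)
    ultimately show ?thesis by (simp add: excess_def gap_def C_def algebra_simps)
  qed
  moreover have "C \<ge> 0" using C10 C20 by (auto simp: C_def intro!: mult_nonneg_nonneg add_nonneg_nonneg sum_nonneg)
  ultimately show ?thesis by blast
qed

text \<open>The old dual step is kept as an admissible shift for the new parameters. The cost is
  then a multiple of its squared norm, which \<open>excess_lower\<close> turns back into the
  excess.\<close>

lemma excess_update:
  assumes "\<And>k. norm (z k) \<le> B"
  shows "excess (lam (Suc k)) (x (Suc k)) (z (Suc k)) \<le> excess (lam k) (x (Suc k)) (z k) +
    4 * (sig k + (lam (Suc k) - lam k)) / lam k *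
      (excess (lam k) (x (Suc k)) (z k) + (norm zstar + B)\<^sup>2 / lam k)"
proof -
  let ?m = "dual_step g (lam k) (x (Suc k)) (z k)" and ?dl = "lam (Suc k) - lam k"
  have reassoc: "a * (4 / l * X) = 4 * a / l * X" for a l X :: real by simp
  have dl: "?dl \<ge> 0" using lam_mono by (simp add: monoD)
  have "Psi g (lam (Suc k)) (x (Suc k)) (z (Suc k)) \<le>
      inner (z (Suc k)) ?m + lam (Suc k) / 2 * (norm ?m)\<^sup>2"
    by (rule Psi_le[OF lam_pos]) (simp add: dual_step_def)
  \<comment> \<open>The multiplier moves along \<open>?m\<close> itself, so its change contributes
    exactly \<open>sig k\<close> times the squared norm.\<close>
  also have "\<dots> = Psi g (lam k) (x (Suc k)) (z k) + (sig k + ?dl / 2) * (norm ?m)\<^sup>2"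
    unfolding Psi_eq[OF lam_pos] z_eq
    by (simp add: inner_add_left power2_norm_eq_inner algebra_simps diff_divide_distrib)
  also have "(sig k + ?dl / 2) * (norm ?m)\<^sup>2 \<le> (sig k + ?dl) * (norm ?m)\<^sup>2"
    using dl by (intro mult_right_mono) auto
  also have "\<dots> \<le> (sig k + ?dl) * (4 / lam k * (excess (lam k) (x (Suc k)) (z k) + (norm zstar + B)\<^sup>2 / lam k))"
  proof (rule mult_left_mono)
    have "4 / lam k * (lam k / 4 * (norm ?m)\<^sup>2) \<le>
        4 / lam k * (excess (lam k) (x (Suc k)) (z k) + (norm zstar + B)\<^sup>2 / lam k)"
      using lam_pos[of k] by (intro mult_left_mono excess_lower x_dom assms) auto
    then show "(norm ?m)\<^sup>2 \<le> 4 / lam k * (excess (lam k) (x (Suc k)) (z k) + (norm zstar + B)\<^sup>2 / lam k)"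
      using lam_pos[of k] by simp
  qed (use dl sig_nonneg[of k] in auto)
  finally have "Psi g (lam (Suc k)) (x (Suc k)) (z (Suc k)) \<le> Psi g (lam k) (x (Suc k)) (z k) +
    4 * (sig k + ?dl) / lam k * (excess (lam k) (x (Suc k)) (z k) + (norm zstar + B)\<^sup>2 / lam k)"
    unfolding reassoc by simp
  moreover have "excess l y w = Psi g l y w + (f y + H y - Lstar)" for l y w
    by (simp add: excess_def aug_fun_def)
  ultimately show ?thesis by simp
qed

end

section \<open>Convergence rates and stationarity\<close>

text \<open>Follows from \<open>ln (1 + u) \<le> u\<close> and \<open>exp t \<ge> 1 + t\<close>; it
  says how much of the target bound an induction loses when the index advances.\<close>

lemma powr_neg_Suc_ge:
  assumes "0 < k" and "0 \<le> (q::real)"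
  shows "real k powr (-q) * (1 - q / k) \<le> real (Suc k) powr (-q)"
proof -
  have k: "real (Suc k) = real k * (1 + 1 / k)" using assms(1) by (simp add: field_simps)
  have "ln (1 + 1 / k) \<le> 1 / real k" by (rule ln_add_one_self_le_self) simp
  then have "q * ln (1 + 1 / k) \<le> q * (1 / real k)" using assms(2) by (rule mult_left_mono)
  then have "1 - q / k \<le> 1 + (- q * ln (1 + 1 / k))" by simp
  also have "\<dots> \<le> exp (- q * ln (1 + 1 / k))" by (rule exp_ge_add_one_self)
  also have "\<dots> = (1 + 1 / real k) powr (-q)"
    using add_pos_nonneg[of 1 "1 / real k"] by (simp add: powr_def)
  finally show ?thesis
    unfolding k using assms(1) by (subst powr_mult) (auto intro!: mult_left_mono)
qed

text \<open>Since \<open>p < 1\<close>, the contraction of order \<open>k powr (-p)\<close>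
  eventually dominates both the growth \<open>c / k\<close> and the index loss \<open>q / k\<close>.
  Half of it pays for these two, the other half for the source term.\<close>

lemma powr_recurrence_bound:
  fixes e al :: "nat \<Rightarrow> real"
  assumes "a > 0" and "p < 1" and "0 \<le> q" and "0 \<le> c" and "0 \<le> C"
    and al_le: "\<And>k. al k \<le> 1"
    and al_ge: "eventually (\<lambda>k. a * real k powr (-p) \<le> al k) sequentially"
    and step: "eventually (\<lambda>k. e (Suc k) \<le>
      (1 + c / k) * ((1 - al k) * e k) + C * real k powr (-p-q)) sequentially"
  shows "\<exists>M\<ge>0. eventually (\<lambda>k. e k \<le> M * real k powr (-q)) sequentially"
proof -
  have "((\<lambda>k. (c + q) * real k powr (p - 1)) \<longlongrightarrow> (c + q) * 0) sequentially"
    using assms(2) by (intro tendsto_mult tendsto_const tendsto_neg_powr filterlim_real_sequentially) auto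
  then have "eventually (\<lambda>k. (c + q) * real k powr (p - 1) < a / 2) sequentially"
    using assms(1) by (intro order_tendstoD) auto
  with al_ge step eventually_gt_at_top[of 0]
  have "eventually (\<lambda>k. 0 < k \<and> a * real k powr (-p) \<le> al k \<and>
      (c + q) * real k powr (p - 1) \<le> a / 2 \<and>
      e (Suc k) \<le> (1 + c / k) * ((1 - al k) * e k) + C * real k powr (-p-q)) sequentially"
    by eventually_elim auto
  then obtain K where K: "\<And>k. k \<ge> K \<Longrightarrow> 0 < k \<and> a * real k powr (-p) \<le> al k \<and>
      (c + q) * real k powr (p - 1) \<le> a / 2 \<and>
      e (Suc k) \<le> (1 + c / k) * ((1 - al k) * e k) + C * real k powr (-p-q)"
    by (auto simp: eventually_sequentially)
  \<comment> \<open>The first entry ensures \<open>C \<le> M * (a / 2)\<close>, the second starts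
    the induction at \<open>K\<close>.\<close>
  define M where "M = max (2 * C / a) (\<bar>e K\<bar> / real K powr (-q))"
  have M0: "M \<ge> 0" using assms by (auto simp: M_def intro!: max.coboundedI1)
  have MC: "C \<le> M * (a / 2)"
  proof -
    have "2 * C / a \<le> M" by (simp add: M_def)
    then show ?thesis using assms(1) by (simp add: field_simps)
  qed
  have "e k \<le> M * real k powr (-q)" if "k \<ge> K" for k
    using that
  proof (induction rule: nat_induct_at_least)
    case base
    have "\<bar>e K\<bar> / real K powr (-q) \<le> M" by (simp add: M_def)
    then show ?case using K[of K] by (simp add: pos_divide_le_eq)
  next
    case (Suc k)
    then have k: "0 < k" "a * real k powr (-p) \<le> al k"
        "(c + q) * real k powr (p - 1) \<le> a / 2"
        "e (Suc k) \<le> (1 + c / k) * ((1 - al k) * e k) + C * real k powr (-p-q)"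
      using K by auto
    let ?q = "real k powr (-q)" and ?p = "real k powr (-p)"
    have cq: "(c + q) / k \<le> a / 2 * ?p"
    proof -
      have "(c + q) / k = ((c + q) * real k powr (p - 1)) * ?p"
        using k(1) by (simp add: powr_diff powr_minus field_simps)
      also have "\<dots> \<le> a / 2 * ?p" using k(3) by (rule mult_right_mono) simp
      finally show ?thesis .
    qed
    have "(1 + c / k) * ((1 - al k) * e k) = ((1 + c / k) * (1 - al k)) * e k" by simp
    also have "\<dots> \<le> ((1 + c / k) * (1 - al k)) * (M * ?q)"
      using Suc.IH assms(4) al_le[of k] by (intro mult_left_mono mult_nonneg_nonneg) auto
    also have "\<dots> \<le> (1 + c / k - a * ?p) * (M * ?q)"
    proof (intro mult_right_mono)
      have "(1 + c / k) * (1 - al k) = 1 + c / k - al k - c / k * al k"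
        by (simp add: ring_distribs diff_divide_distrib)
      moreover have "0 \<le> c / k * al k"
        using assms(1,4) k(2) by (intro mult_nonneg_nonneg) (auto intro: order_trans[rotated])
      ultimately show "(1 + c / k) * (1 - al k) \<le> 1 + c / k - a * ?p" using k(2) by linarith
    qed (use M0 in auto)
    finally have "e (Suc k) \<le> (1 + c / k - a * ?p) * (M * ?q) + C * real k powr (-p-q)"
      using k(4) by linarith
    also have "C * real k powr (-p-q) \<le> (M * (a / 2)) * (?p * ?q)"
      using mult_right_mono[OF MC, of "real k powr (-p-q)"] by (simp add: powr_add[symmetric])
    \<comment> \<open>Writing \<open>c / k\<close> as \<open>(c + q) / k - q / k\<close> isolates
      the factor \<open>1 - q / k\<close>; the remaining bracket is nonpositive by
      \<open>cq\<close>.\<close>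
    also have "(1 + c / k - a * ?p) * (M * ?q) + (M * (a / 2)) * (?p * ?q) =
        (M * ?q) * (1 - q / k + ((c + q) / k - a / 2 * ?p))"
      by (simp add: algebra_simps add_divide_distrib)
    also have "\<dots> \<le> (M * ?q) * (1 - q / k)"
      using cq M0 by (intro mult_left_mono) auto
    also have "\<dots> = M * (?q * (1 - q / k))" by simp
    also have "\<dots> \<le> M * real (Suc k) powr (-q)"
      using powr_neg_Suc_ge[OF k(1) assms(3)] M0 by (intro mult_left_mono) auto
    finally show ?case by simp
  qed
  then show ?thesis using M0 by (auto simp: eventually_sequentially)
qed

lemma bigtheta_powr_bounds:
  assumes "s \<in> \<Theta>(\<lambda>k. real k powr r)" and "\<And>k. 0 < s k"
  obtains a b where "a > 0" and "b > 0"
    and "eventually (\<lambda>k. a * real k powr r \<le> s k \<and> s k \<le> b * real k powr r) sequentially"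
proof -
  have "s \<in> O(\<lambda>k. real k powr r)" "s \<in> \<Omega>(\<lambda>k. real k powr r)"
    using assms(1) by (auto simp: bigtheta_def)
  then obtain a b where ab: "a > 0" "b > 0"
      "eventually (\<lambda>k. norm (s k) \<le> b * norm (real k powr r)) sequentially"
      "eventually (\<lambda>k. norm (s k) \<ge> a * norm (real k powr r)) sequentially"
    by (elim landau_o.bigE landau_omega.bigE) blast
  have "eventually (\<lambda>k. a * real k powr r \<le> s k \<and> s k \<le> b * real k powr r) sequentially"
    using ab(3,4)
  proof eventually_elim
    case (elim k)
    then show ?case using assms(2)[of k] by simp
  qed
  with ab(1,2) show thesis by (rule that)
qed

section \<open>Rates for the excess and the residuals\<close>

locale single_loop_rates = single_loop +
  fixes tau p gam :: real
  assumes lam_inf: "filterlim lam at_top sequentially"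
    and tau_pos: "0 < tau"
    and lam_rate: "lam \<in> \<Theta>(\<lambda>k. real k powr tau)"
    and lam_diff: "(\<lambda>k. lam (Suc k) - lam k) \<in> O(\<lambda>k. real k powr (-(1 - tau)))"
    and alpha_pos: "\<And>k. 0 < alpha k"
    and p: "tau < p" "p < 1"
    and alpha_rate: "alpha \<in> \<Theta>(\<lambda>k. real k powr (-p))"
    and sig_pos: "\<And>k. 0 < sig k"
    and gam_pos: "0 < gam"
    and sig_rate: "sig \<in> \<Theta>(\<lambda>k. real k powr (-(1 + gam)))"
begin

text \<open>The slower of the two decay rates: for positive \<open>k\<close> the larger of the two
  claimed powers is \<open>k powr (-q)\<close>.\<close>

definition "q = min (p - tau) tau"
abbreviation "E k \<equiv> excess (lam k) (x k) (z k)"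

lemma q_pos: "0 < q"
  using tau_pos p by (simp add: q_def)

text \<open>Both error terms fit under the exponent \<open>-p-q\<close>: the primal one has exponent
  \<open>tau - 2 * p\<close>, which is \<open>-p - (p - tau)\<close>, and the update error has
  \<open>-1 - tau\<close>, which is below \<open>-p - tau\<close>.\<close>

lemma excess_steps:
  obtains c C where "0 \<le> c" and "0 \<le> C"
    and "eventually (\<lambda>k.
      excess (lam k) (x (Suc k)) (z k) \<le> E k - alpha k * gap k + C * real k powr (-p-q) \<and>
      E (Suc k) \<le> (1 + c / k) * excess (lam k) (x (Suc k)) (z k) + C * real k powr (-p-q)) sequentially"
proof -
  obtain B where B: "B \<ge> 0" "\<And>k. norm (z k) \<le> B" using z_bounded by blast
  obtain C0 where C0: "C0 \<ge> 0" "\<And>k. excess (lam k) (x (Suc k)) (z k) \<le>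
      E k - alpha k * gap k + C0 * lam k * (alpha k)\<^sup>2" using excess_descent by blast
  obtain a b where ab: "a > 0" "b > 0"
      "eventually (\<lambda>k. a * real k powr tau \<le> lam k \<and> lam k \<le> b * real k powr tau) sequentially"
    using lam_rate lam_pos by (rule bigtheta_powr_bounds)
  obtain a' b' where ab': "a' > 0" "b' > 0"
      "eventually (\<lambda>k. a' * real k powr (-p) \<le> alpha k \<and> alpha k \<le> b' * real k powr (-p)) sequentially"
    using alpha_rate alpha_pos by (rule bigtheta_powr_bounds)
  obtain s' s where s: "s' > 0" "s > 0"
      "eventually (\<lambda>k. s' * real k powr (-(1 + gam)) \<le> sig k \<and> sig k \<le> s * real k powr (-(1 + gam))) sequentially"
    using sig_rate sig_pos by (rule bigtheta_powr_bounds)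
  obtain d where d: "d > 0"
      "eventually (\<lambda>k. norm (lam (Suc k) - lam k) \<le> d * norm (real k powr (-(1 - tau)))) sequentially"
    using lam_diff by (elim landau_o.bigE)
  define Z where "Z = (norm zstar + B)\<^sup>2"
  define c where "c = 4 * (s + d) / a"
  define C where "C = max (C0 * (b * b'\<^sup>2)) (c * (Z / a))"
  have c0: "c \<ge> 0" using s d ab by (simp add: c_def)
  have Z0: "Z \<ge> 0" by (simp add: Z_def)
  have "eventually (\<lambda>k.
      excess (lam k) (x (Suc k)) (z k) \<le> E k - alpha k * gap k + C * real k powr (-p-q) \<and>
      E (Suc k) \<le> (1 + c / k) * excess (lam k) (x (Suc k)) (z k) + C * real k powr (-p-q)) sequentially"
    using ab(3) ab'(3) s(3) d(2) eventually_gt_at_top[of 0]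
  proof eventually_elim
    case (elim k)
    let ?e = "excess (lam k) (x (Suc k)) (z k)"
    have k1: "real k \<ge> 1" using elim(5) by simp
    have lpos: "lam k > 0" by (rule lam_pos)
    have "C0 * lam k * (alpha k)\<^sup>2 \<le> C0 * (b * real k powr tau) * (b' * real k powr (-p))\<^sup>2"
      using elim(1,2) C0(1) alpha_pos[of k] lpos ab(2)
      by (intro mult_mono power_mono mult_left_mono mult_nonneg_nonneg) (auto simp: less_imp_le)
    also have "\<dots> = C0 * (b * b'\<^sup>2) * real k powr (tau + (-p) + (-p))"
      by (simp only: powr_add power2_eq_square mult_ac)
    also have "\<dots> \<le> C * real k powr (-p-q)"
      using k1 C0(1) ab(2) by (intro mult_mono powr_mono) (auto simp: C_def q_def le_max_iff_disj)
    finally have 1: "C0 * lam k * (alpha k)\<^sup>2 \<le> C * real k powr (-p-q)" .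
    have dl: "0 \<le> lam (Suc k) - lam k" using lam_mono by (simp add: monoD)
    have "sig k \<le> s * real k powr (tau - 1)"
    proof -
      have "real k powr (-(1 + gam)) \<le> real k powr (tau - 1)"
        using k1 tau_pos gam_pos by (intro powr_mono) auto
      then have "s * real k powr (-(1 + gam)) \<le> s * real k powr (tau - 1)" using s(2) by simp
      then show ?thesis using elim(3) by linarith
    qed
    moreover have "lam (Suc k) - lam k \<le> d * real k powr (tau - 1)" using elim(4) dl by simp
    ultimately have "4 * (sig k + (lam (Suc k) - lam k)) / lam k \<le>
        4 * ((s + d) * real k powr (tau - 1)) / (a * real k powr tau)"
      using elim(1) ab(1) k1 s(2) d(1) by (intro frac_le mult_left_mono) (auto simp: distrib_right)
    also have "\<dots> = c / k"
      using k1 ab(1) by (simp add: c_def powr_diff field_simps)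
    finally have kap: "4 * (sig k + (lam (Suc k) - lam k)) / lam k \<le> c / k" .
    have "0 \<le> lam k / 4 * (norm (dual_step g (lam k) (x (Suc k)) (z k)))\<^sup>2" using lpos by simp
    also have "\<dots> \<le> ?e + Z / lam k"
      unfolding Z_def using x_dom lpos B(2) by (rule excess_lower)
    \<comment> \<open>The excess alone may be negative; this sum is not, which permits multiplying
      the bound \<open>kap\<close> by it.\<close>
    finally have X: "0 \<le> ?e + Z / lam k" .
    have "E (Suc k) \<le> ?e + 4 * (sig k + (lam (Suc k) - lam k)) / lam k * (?e + Z / lam k)"
      unfolding Z_def using B(2) by (rule excess_update)
    also have "\<dots> \<le> ?e + c / k * (?e + Z / lam k)"
      using kap X by (intro add_left_mono mult_right_mono)
    also have "\<dots> = (1 + c / k) * ?e + c / k * (Z / lam k)" by (simp add: distrib_left distrib_right)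
    also have "c / k * (Z / lam k) \<le> c / k * (Z / (a * real k powr tau))"
      using elim(1) ab(1) k1 Z0 c0 by (intro mult_left_mono divide_left_mono mult_pos_pos lpos) auto
    also have "\<dots> = c * (Z / a) * real k powr (-1 + -tau)"
      unfolding powr_add using k1 ab(1) by (simp add: powr_minus field_simps)
    also have "\<dots> \<le> C * real k powr (-p-q)"
      using k1 c0 Z0 ab(1) p by (intro mult_mono powr_mono) (auto simp: C_def q_def le_max_iff_disj)
    finally have "E (Suc k) \<le> (1 + c / k) * ?e + C * real k powr (-p-q)" by simp
    then show ?case using C0(2)[of k] 1 by linarith
  qed
  moreover have "C \<ge> 0" using c0 Z0 ab(1) by (auto simp: C_def le_max_iff_disj)
  ultimately show thesis using c0 that by blast
qed

lemma excess_rate: "\<exists>M\<ge>0. eventually (\<lambda>k. E k \<le> M * real k powr (-q)) sequentially"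
proof -
  obtain c C where c: "0 \<le> c" "0 \<le> C" "eventually (\<lambda>k.
      excess (lam k) (x (Suc k)) (z k) \<le> E k - alpha k * gap k + C * real k powr (-p-q) \<and>
      E (Suc k) \<le> (1 + c / k) * excess (lam k) (x (Suc k)) (z k) + C * real k powr (-p-q)) sequentially"
    by (rule excess_steps)
  obtain a b where ab: "a > 0" "b > 0"
      "eventually (\<lambda>k. a * real k powr (-p) \<le> alpha k \<and> alpha k \<le> b * real k powr (-p)) sequentially"
    using alpha_rate alpha_pos by (rule bigtheta_powr_bounds)
  show ?thesis
  \<comment> \<open>The primal error is amplified by \<open>1 + c / k \<le> 1 + c\<close>; the last
    \<open>C\<close> is the update error.\<close>
  proof (rule powr_recurrence_bound[where a = a and p = p and c = c and C = "(1 + c) * C + C" and al = alpha])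
    show "eventually (\<lambda>k. a * real k powr (-p) \<le> alpha k) sequentially"
      using ab(3) by eventually_elim simp
    show "eventually (\<lambda>k. E (Suc k) \<le> (1 + c / k) * ((1 - alpha k) * E k) +
        ((1 + c) * C + C) * real k powr (-p-q)) sequentially"
      using c(3) eventually_gt_at_top[of 0]
    proof eventually_elim
      case (elim k)
      let ?r = "C * real k powr (-p-q)"
      have "alpha k * E k \<le> alpha k * gap k"
        using excess_le_gap alpha_pos[of k] by (intro mult_left_mono) auto
      then have "excess (lam k) (x (Suc k)) (z k) \<le> (1 - alpha k) * E k + ?r"
        using elim(1) by (simp add: algebra_simps)
      then have "(1 + c / k) * excess (lam k) (x (Suc k)) (z k) \<le> (1 + c / k) * ((1 - alpha k) * E k + ?r)"
        using c(1) by (intro mult_left_mono) auto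
      moreover have "(1 + c / k) * ?r \<le> (1 + c) * ?r"
        using c(1,2) elim(2) by (intro mult_right_mono) (auto simp: divide_le_eq mult_le_cancel_left1)
      ultimately show ?case using elim(1) by (simp add: algebra_simps)
    qed
  qed (use ab c p q_pos alpha_range in auto)
qed

text \<open>In \<open>excess_lower\<close> the right-hand side is \<open>O(k powr (-q))\<close>;
  dividing by \<open>lam k\<close> gains a further \<open>k powr (-tau)\<close>, at most
  \<open>k powr (-q)\<close>, so the square root has rate \<open>q\<close>.\<close>

lemma dual_step_rate:
  "\<exists>M\<ge>0. eventually (\<lambda>k. norm (dual_step g (lam k) (x k) (z k)) \<le> M * real k powr (-q)) sequentially"
proof -
  obtain B where B: "B \<ge> 0" "\<And>k. norm (z k) \<le> B" using z_bounded by blast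
  obtain M where M: "M \<ge> 0" "eventually (\<lambda>k. E k \<le> M * real k powr (-q)) sequentially"
    using excess_rate by blast
  obtain a b where ab: "a > 0" "b > 0"
      "eventually (\<lambda>k. a * real k powr tau \<le> lam k \<and> lam k \<le> b * real k powr tau) sequentially"
    using lam_rate lam_pos by (rule bigtheta_powr_bounds)
  define Z where "Z = (norm zstar + B)\<^sup>2"
  define N where "N = 4 / a * (M + Z / a)"
  have Z0: "Z \<ge> 0" by (simp add: Z_def)
  have N0: "N \<ge> 0" using Z0 M(1) ab(1) by (simp add: N_def)
  have "eventually (\<lambda>k. norm (dual_step g (lam k) (x k) (z k)) \<le> sqrt N * real k powr (-q)) sequentially"
    using M(2) ab(3) eventually_gt_at_top[of 0]
  proof eventually_elim
    case (elim k)
    let ?m = "norm (dual_step g (lam k) (x k) (z k))" and ?t = "real k powr tau"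
    have k1: "real k \<ge> 1" using elim(3) by simp
    have t0: "?t > 0" using k1 by simp
    have tinv: "1 / ?t \<le> real k powr (-q)"
      using powr_mono[of "- tau" "- q" "real k"] k1 by (simp add: powr_minus_divide[symmetric] q_def)
    have "a * ?t / 4 * ?m\<^sup>2 \<le> lam k / 4 * ?m\<^sup>2"
      using elim(2) by (intro mult_right_mono) auto
    also have "\<dots> \<le> E k + Z / lam k"
      unfolding Z_def using x_dom lam_pos B(2) by (rule excess_lower)
    also have "Z / lam k \<le> Z / (a * ?t)"
      using elim(2) ab(1) t0 Z0 by (intro divide_left_mono mult_pos_pos lam_pos) auto
    also have "Z / (a * ?t) = Z / a * (1 / ?t)" by simp
    also have "\<dots> \<le> Z / a * real k powr (-q)"
      using tinv Z0 ab(1) by (intro mult_left_mono) auto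
    finally have "a * ?t / 4 * ?m\<^sup>2 \<le> (M + Z / a) * real k powr (-q)"
      using elim(1) by (simp add: distrib_right)
    then have "?m\<^sup>2 \<le> N * real k powr (-q) * (1 / ?t)"
      using ab(1) t0 by (simp add: N_def field_simps)
    also have "\<dots> \<le> N * real k powr (-q) * real k powr (-q)"
      using tinv N0 by (intro mult_left_mono) auto
    also have "\<dots> = (sqrt N * real k powr (-q))\<^sup>2"
      using N0 by (simp add: power_mult_distrib power2_eq_square)
    finally show ?case
      using N0 by (rule_tac power2_le_imp_le) auto
  qed
  then show ?thesis using N0 by (intro exI[of _ "sqrt N"]) auto
qed

lemma norm_pos_part_le: "norm (pos_part (g (x k))) \<le> norm (dual_step g (lam k) (x k) (z k))"
proof (rule norm_le_componentwise_cart)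
  fix i
  have "- (z k $ i) / lam k \<le> 0" using z_nonneg[of k i] lam_pos[of k] by simp
  then show "norm (pos_part (g (x k)) $ i) \<le> norm (dual_step g (lam k) (x k) (z k) $ i)"
    unfolding pos_part_def dual_step_def by (simp add: max_def)
qed

text \<open>The dual step dominates the violation. From below, the Lagrangian bound charges the
  violation to \<open>zstar\<close>; from above, dropping the quadratic part of the excess leaves
  the inner product with the bounded \<open>z k\<close>.\<close>

lemma convergence_rate:
  "\<exists>C\<ge>0. eventually (\<lambda>k. \<bar>f (x k) + H (x k) - Lstar\<bar> \<le> C * real k powr (-q) \<and>
     norm (pos_part (g (x k))) \<le> C * real k powr (-q)) sequentially"
proof -
  obtain B where B: "B \<ge> 0" "\<And>k. norm (z k) \<le> B" using z_bounded by blast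
  obtain M where M: "M \<ge> 0" "eventually (\<lambda>k. E k \<le> M * real k powr (-q)) sequentially"
    using excess_rate by blast
  obtain N where N: "N \<ge> 0" "eventually (\<lambda>k.
      norm (dual_step g (lam k) (x k) (z k)) \<le> N * real k powr (-q)) sequentially"
    using dual_step_rate by blast
  define C where "C = M + (B + norm zstar + 1) * N"
  have "eventually (\<lambda>k. \<bar>f (x k) + H (x k) - Lstar\<bar> \<le> C * real k powr (-q) \<and>
     norm (pos_part (g (x k))) \<le> C * real k powr (-q)) sequentially"
    using M(2) N(2)
  proof eventually_elim
    case (elim k)
    let ?m = "dual_step g (lam k) (x k) (z k)" and ?r = "real k powr (-q)"
    have r: "0 \<le> M * ?r" "0 \<le> B * (N * ?r)" "0 \<le> norm zstar * (N * ?r)" "0 \<le> N * ?r"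
      using M N B by auto
    have Cr: "C * ?r = M * ?r + B * (N * ?r) + norm zstar * (N * ?r) + N * ?r"
      by (simp add: C_def algebra_simps)
    have "inner zstar (g (x k)) \<le> norm zstar * norm (pos_part (g (x k)))"
      by (rule inner_zstar_le) (simp add: pos_part_def)
    also have "\<dots> \<le> norm zstar * (N * ?r)"
      using norm_pos_part_le[of k] elim(2) by (intro mult_left_mono) auto
    finally have low: "Lstar - norm zstar * (N * ?r) \<le> f (x k) + H (x k)"
      using lagrangian_ge[OF x_dom, of k] by simp
    have "- inner (z k) ?m \<le> norm (z k) * norm ?m"
      using Cauchy_Schwarz_ineq2[of "z k" ?m] by simp
    also have "\<dots> \<le> B * (N * ?r)"
      using elim(2) B by (intro mult_mono) auto
    finally have ip: "- inner (z k) ?m \<le> B * (N * ?r)" .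
    have "f (x k) + H (x k) - Lstar \<le> E k + B * (N * ?r)"
    proof -
      have "E k = f (x k) + (inner (z k) ?m + lam k / 2 * (norm ?m)\<^sup>2) + H (x k) - Lstar"
        by (simp add: excess_def aug_fun_def Psi_eq[OF lam_pos])
      moreover have "0 \<le> lam k / 2 * (norm ?m)\<^sup>2" using lam_pos[of k] by simp
      ultimately show ?thesis using ip by linarith
    qed
    then show ?case
      using low elim norm_pos_part_le[of k] r unfolding Cr abs_le_iff by (intro conjI; linarith)
  qed
  moreover have "C \<ge> 0" using M N B by (simp add: C_def)
  ultimately show ?thesis by blast
qed

text \<open>A gap bounded away from \<open>0\<close> would force \<open>\<Sum>k. k powr (-p)\<close> to converge by telescoping
  the excess, which is bounded below.\<close>

lemma gap_frequently_small:
  assumes "\<epsilon> > 0"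
  shows "\<not> eventually (\<lambda>k. gap k \<ge> \<epsilon>) sequentially"
proof
  assume ge: "eventually (\<lambda>k. gap k \<ge> \<epsilon>) sequentially"
  obtain B where B: "B \<ge> 0" "\<And>k. norm (z k) \<le> B" using z_bounded by blast
  obtain M where M: "M \<ge> 0" "eventually (\<lambda>k. E k \<le> M * real k powr (-q)) sequentially"
    using excess_rate by blast
  obtain c C where c: "0 \<le> c" "0 \<le> C" "eventually (\<lambda>k.
      excess (lam k) (x (Suc k)) (z k) \<le> E k - alpha k * gap k + C * real k powr (-p-q) \<and>
      E (Suc k) \<le> (1 + c / k) * excess (lam k) (x (Suc k)) (z k) + C * real k powr (-p-q)) sequentially"
    by (rule excess_steps)
  obtain a b where ab: "a > 0" "b > 0"
      "eventually (\<lambda>k. a * real k powr (-p) \<le> alpha k \<and> alpha k \<le> b * real k powr (-p)) sequentially"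
    using alpha_rate alpha_pos by (rule bigtheta_powr_bounds)
  \<comment> \<open>The two source terms of \<open>excess_steps\<close>, plus the growth
    \<open>c / k\<close> times the bound \<open>(M + C) * k powr (-q)\<close> on the intermediate
    excess.\<close>
  define C3 where "C3 = 2 * C + c * (M + C)"
  \<comment> \<open>The total error is \<open>C3 * k powr (-q)\<close> times
    \<open>k powr (-p)\<close>, so eventually it consumes at most half of the decrease
    \<open>\<epsilon> * a * k powr (-p)\<close>.\<close>
  have "((\<lambda>k. C3 * real k powr (-q)) \<longlongrightarrow> C3 * 0) sequentially"
    using q_pos by (intro tendsto_mult tendsto_const tendsto_neg_powr filterlim_real_sequentially) auto
  then have "eventually (\<lambda>k. C3 * real k powr (-q) < \<epsilon> * a / 2) sequentially"
    using assms ab(1) by (intro order_tendstoD) auto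
  with ge M(2) c(3) ab(3) eventually_gt_at_top[of 0]
  have "eventually (\<lambda>k. \<epsilon> * a / 2 * real k powr (-p) \<le> E k - E (Suc k)) sequentially"
  proof eventually_elim
    case (elim k)
    let ?e = "excess (lam k) (x (Suc k)) (z k)" and ?s = "real k powr (-p-q)" and ?r = "real k powr (-q)"
    have k1: "real k \<ge> 1" using elim(5) by simp
    have sr: "?s \<le> ?r" using k1 p tau_pos by (intro powr_mono) auto
    have "\<epsilon> * a * real k powr (-p) \<le> gap k * alpha k"
      using mult_mono[of \<epsilon> "gap k" "a * real k powr (-p)" "alpha k"] elim(1,4) assms ab(1) gap_nonneg[of k]
      by (simp add: mult.assoc)
    moreover have "0 \<le> gap k * alpha k" using gap_nonneg[of k] alpha_pos[of k] by simp
    moreover have "?e \<le> M * ?r + C * ?r"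
      using elim(2,3) calculation(2) mult_left_mono[OF sr c(2)] by (simp add: mult.commute)
    then have "c / k * ?e \<le> c / k * ((M + C) * ?r)"
      using c(1) by (intro mult_left_mono) (auto simp: distrib_right)
    moreover have "c / k * ((M + C) * ?r) = c * (M + C) * real k powr (-1 + -q)"
      unfolding powr_add using k1 by (simp add: powr_minus field_simps)
    moreover have "c * (M + C) * real k powr (-1 + -q) \<le> c * (M + C) * ?s"
      using k1 p c M by (intro mult_left_mono powr_mono) auto
    moreover have "(1 + c / k) * ?e = ?e + c / k * ?e" by (simp add: distrib_right)
    ultimately have "\<epsilon> * a * real k powr (-p) \<le> E k - E (Suc k) + C3 * ?s"
      using elim(3) by (simp add: C3_def distrib_right mult.commute[of "gap k"])
    moreover have "C3 * ?s = C3 * ?r * real k powr (-p)"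
      by (simp add: powr_diff powr_minus divide_inverse)
    moreover have "C3 * ?r * real k powr (-p) \<le> \<epsilon> * a / 2 * real k powr (-p)"
      using elim(6) by (intro mult_right_mono) auto
    ultimately show ?case by simp
  qed
  then obtain K where K: "\<And>k. k \<ge> K \<Longrightarrow> \<epsilon> * a / 2 * real k powr (-p) \<le> E k - E (Suc k)"
    by (auto simp: eventually_sequentially)
  define Z where "Z = (norm zstar + B)\<^sup>2 / lam 0"
  have Elow: "- Z \<le> E k" for k
  proof -
    have "0 \<le> lam k / 4 * (norm (dual_step g (lam k) (x k) (z k)))\<^sup>2" using lam_pos[of k] by simp
    also have "\<dots> \<le> E k + (norm zstar + B)\<^sup>2 / lam k"
      using x_dom lam_pos B(2) by (rule excess_lower)
    also have "(norm zstar + B)\<^sup>2 / lam k \<le> Z"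
      unfolding Z_def using lam_mono by (intro divide_left_mono mult_pos_pos lam_pos) (auto simp: monoD)
    finally show ?thesis by simp
  qed
  have "summable (\<lambda>n. \<epsilon> * a / 2 * real (n + K) powr (-p))"
  proof (rule summableI_nonneg_bounded)
    fix n
    have "(\<Sum>i<n. \<epsilon> * a / 2 * real (i + K) powr (-p)) \<le> (\<Sum>i<n. E (i + K) - E (Suc i + K))"
    proof (rule sum_mono)
      show "\<epsilon> * a / 2 * real (i + K) powr (-p) \<le> E (i + K) - E (Suc i + K)" for i
        using K[of "i + K"] by (simp only: add_Suc le_add2)
    qed
    also have "\<dots> = E K - E (n + K)" by (subst sum_lessThan_telescope') simp
    also have "\<dots> \<le> E K + Z" using Elow[of "n + K"] by simp
    finally show "(\<Sum>i<n. \<epsilon> * a / 2 * real (i + K) powr (-p)) \<le> E K + Z" .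
  qed (use assms ab in auto)
  then have "summable (\<lambda>n. \<epsilon> * a / 2 * real n powr (-p))"
    by (rule summable_iff_shift[THEN iffD1])
  then have "summable (\<lambda>n. real n powr (-p))"
    using assms ab(1) by (subst (asm) summable_cmult_iff) auto
  then show False using p by (simp add: summable_real_powr_iff)
qed

text \<open>The nonnegative gap falls below any tolerance at arbitrarily late indices, so increasing
  indices with gap below \<open>1 / (n + 1)\<close> can be chosen in turn.\<close>

lemma gap_subseq: "\<exists>r. strict_mono r \<and> (gap \<circ> r) \<longlonglongrightarrow> 0"
proof -
  have ex: "\<exists>k>N. gap k < \<epsilon>" if "\<epsilon> > 0" for N \<epsilon>
    using gap_frequently_small[OF that] unfolding eventually_sequentially
    by (metis Suc_le_eq not_le)
  have "\<exists>r. \<forall>n. gap (r n) < inverse (real (Suc n)) \<and> r n < r (Suc n)"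
  proof (rule dependent_nat_choice)
    show "\<exists>k. gap k < inverse (real (Suc 0))" using ex[of 1 0] by auto
    show "\<exists>k'. gap k' < inverse (real (Suc (Suc n))) \<and> k < k'" for k n
      using ex[of "inverse (real (Suc (Suc n)))" k] by auto
  qed
  then obtain r where r: "\<And>n. gap (r n) < inverse (real (Suc n))" "\<And>n. r n < r (Suc n)" by blast
  have "(gap \<circ> r) \<longlonglongrightarrow> 0"
    by (rule tendsto_sandwich[OF _ _ tendsto_const LIMSEQ_inverse_real_of_nat])
      (auto intro!: always_eventually simp: gap_nonneg r(1)[THEN less_imp_le] simp del: of_nat_Suc)
  then show ?thesis using r(2) by (auto simp: strict_mono_Suc_iff)
qed

section \<open>Passage to the limit in the KKT conditions\<close>

lemma residual_limits:
  shows "(\<lambda>k. f (x k) + H (x k)) \<longlonglongrightarrow> Lstar" and "(\<lambda>k. norm (pos_part (g (x k)))) \<longlonglongrightarrow> 0"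
proof -
  obtain C where C: "C \<ge> 0" "eventually (\<lambda>k. \<bar>f (x k) + H (x k) - Lstar\<bar> \<le> C * real k powr (-q) \<and>
     norm (pos_part (g (x k))) \<le> C * real k powr (-q)) sequentially"
    using convergence_rate by blast
  have "((\<lambda>k. C * real k powr (-q)) \<longlongrightarrow> C * 0) sequentially"
    using q_pos by (intro tendsto_mult tendsto_const tendsto_neg_powr filterlim_real_sequentially) auto
  then have lim: "((\<lambda>k. C * real k powr (-q)) \<longlongrightarrow> 0) sequentially" by simp
  have "(\<lambda>k. f (x k) + H (x k) - Lstar) \<longlonglongrightarrow> 0"
    by (rule Lim_null_comparison[OF _ lim]) (use C(2) in \<open>auto elim: eventually_mono\<close>)
  then show "(\<lambda>k. f (x k) + H (x k)) \<longlonglongrightarrow> Lstar" by (rule LIM_zero_cancel)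
  show "(\<lambda>k. norm (pos_part (g (x k)))) \<longlonglongrightarrow> 0"
    by (rule Lim_null_comparison[OF _ lim]) (use C(2) in \<open>auto elim: eventually_mono\<close>)
qed

text \<open>Lower semicontinuity of \<open>h\<close> in epigraph form: only the upper bounds
  \<open>\<rho>\<close> have to converge, not the values \<open>H (y k)\<close>.\<close>

lemma epigraph_limit:
  assumes "y \<longlonglongrightarrow> y0" and "\<rho> \<longlonglongrightarrow> \<rho>0" and "\<And>k. y k \<in> S" and "\<And>k. H (y k) \<le> \<rho> k"
  shows "h y0 \<le> ereal \<rho>0"
proof -
  have "(y k, \<rho> k) \<in> epigraph_ereal h" for k
    by (rule dom_real[OF assms(3)[of k]]) (use assms(4)[of k] in \<open>simp add: epigraph_ereal_def\<close>)
  then have "(y0, \<rho>0) \<in> epigraph_ereal h"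
    using tendsto_Pair[OF assms(1,2)] by (rule closed_sequentially[OF h_closed[unfolded closed_fun_def]])
  then show ?thesis by (simp add: epigraph_ereal_def)
qed

text \<open>Stationarity is the limit of \<open>gap_ge\<close> as the gap vanishes, feasibility
  comes from the residual rate, and complementarity from \<open>lam\<close> tending to infinity
  while \<open>z\<close> stays bounded.\<close>

lemma KKT_limit:
  assumes t: "strict_mono t" and xlim: "(\<lambda>k. x (t k)) \<longlonglongrightarrow> xbar"
    and wlim: "(\<lambda>k. multiplier (t k)) \<longlonglongrightarrow> zbar" and gap: "(\<lambda>k. gap (t k)) \<longlonglongrightarrow> 0"
  shows "KKT_point f h g xbar zbar"
proof -
  have sub: "filterlim t sequentially sequentially" using t by (rule filterlim_subseq)
  have fcont: "isCont f y" for y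
    using f_diff by (rule differentiable_imp_continuous_within)
  have gcont: "isCont (\<lambda>y. g y $ i) y" for i y
    using g_diff by (rule differentiable_imp_continuous_within)
  have flim: "(\<lambda>k. f (x (t k))) \<longlonglongrightarrow> f xbar" using fcont xlim by (rule isCont_tendsto_compose)
  have glim: "(\<lambda>k. g (x (t k)) $ i) \<longlonglongrightarrow> g xbar $ i" for i using gcont xlim by (rule isCont_tendsto_compose)
  have "(\<lambda>k. f (x (t k)) + H (x (t k))) \<longlonglongrightarrow> Lstar"
    using residual_limits(1) sub by (rule filterlim_compose)
  \<comment> \<open>Membership of \<open>xbar\<close> in the domain has to come first: the
    constraint gradients are assumed Lipschitz only there.\<close>
  from tendsto_diff[OF this flim] have "(\<lambda>k. H (x (t k))) \<longlonglongrightarrow> Lstar - f xbar" by simp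
  then have "h xbar \<le> ereal (Lstar - f xbar)"
    using xlim x_dom by (intro epigraph_limit) auto
  then have xbar: "xbar \<in> S" by (auto simp: effective_domain_def)
  have lip: "(\<lambda>k. F (x (t k))) \<longlonglongrightarrow> F xbar" if "L-lipschitz_on S F" for L and F :: "'a \<Rightarrow> 'a"
  proof -
    have "continuous_on S F" using that by (rule lipschitz_on_continuous_on)
    then show ?thesis by (rule continuous_on_tendsto_compose[OF _ xlim xbar]) (simp add: x_dom)
  qed
  define u where "u = lag_grad zbar xbar"
  have ulim: "(\<lambda>k. lag_grad (multiplier (t k)) (x (t k))) \<longlonglongrightarrow> u"
    unfolding u_def lag_grad_def
    by (intro tendsto_add tendsto_sum tendsto_scaleR tendsto_vec_nth wlim lip[OF g_smooth]
        lip[OF lipschitz_on_subset[OF f_smooth]]) simp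
  have "h xbar + ereal (inner (- u) (y - xbar)) \<le> h y" for y
  proof (cases "y \<in> S")
    case True
    \<comment> \<open>This is \<open>gap_ge\<close> solved for \<open>H (x (t k))\<close>; its limit
      is the subgradient inequality for \<open>- u\<close>.\<close>
    let ?\<rho> = "\<lambda>k. gap (t k) + H y - inner (lag_grad (multiplier (t k)) (x (t k))) (x (t k) - y)"
    have "?\<rho> \<longlonglongrightarrow> 0 + H y - inner u (xbar - y)"
      by (intro tendsto_intros gap ulim xlim)
    moreover have "H (x (t k)) \<le> ?\<rho> k" for k
      using gap_ge[OF True, of "t k"] by simp
    ultimately have "h xbar \<le> ereal (0 + H y - inner u (xbar - y))"
      using xlim x_dom by (intro epigraph_limit)
    moreover obtain r r' where "h xbar = ereal r" "h y = ereal r'"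
      using True xbar by (metis dom_real)
    ultimately show ?thesis by (simp add: inner_diff_right)
  next
    case False
    then show ?thesis by (simp add: effective_domain_def)
  qed
  then have "- u \<in> subdifferential h xbar"
    using xbar by (simp add: subdifferential_def effective_domain_def)
  moreover have "gradient f xbar + (- u) + (\<Sum>i\<in>UNIV. (zbar $ i) *\<^sub>R Dg i xbar) = 0"
    by (simp add: u_def lag_grad_def)
  moreover have gneg: "g xbar $ i \<le> 0" for i
  proof -
    have "(\<lambda>k. norm (pos_part (g (x (t k))))) \<longlonglongrightarrow> 0"
      using residual_limits(2) sub by (rule filterlim_compose)
    from LIMSEQ_le[OF glim this, of i] show ?thesis
      using component_le_norm_cart[of "pos_part (g (x (t k)))" i for k] 
      by (auto simp: pos_part_def)
  qed
  moreover have wi: "(\<lambda>k. multiplier (t k) $ i) \<longlonglongrightarrow> zbar $ i" for i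
    using wlim by (rule tendsto_vec_nth)
  moreover have zbar0: "0 \<le> zbar $ i" for i
    by (rule LIMSEQ_le_const[OF wi]) (simp add: multiplier_def pos_part_def)
  moreover have "zbar $ i * g xbar $ i = 0" for i
  proof (cases "g xbar $ i = 0")
    case False
    then have neg: "g xbar $ i < 0" using gneg[of i] by simp
    obtain B where B: "B \<ge> 0" "\<And>k. norm (z k) \<le> B" using z_bounded by blast
    \<comment> \<open>Half of the slack of an inactive constraint survives along the sequence, and
      once \<open>lam\<close> exceeds \<open>B / \<delta>\<close> the positive part in the
      multiplier vanishes.\<close>
    define \<delta> where "\<delta> = - g xbar $ i / 2"
    have \<delta>: "\<delta> > 0" using neg by (simp add: \<delta>_def)
    have "eventually (\<lambda>k. g (x (t k)) $ i < - \<delta>) sequentially"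
      using neg by (intro order_tendstoD(2)[OF glim]) (simp add: \<delta>_def)
    moreover have "eventually (\<lambda>k. B / \<delta> \<le> lam (t k)) sequentially"
      using filterlim_compose[OF lam_inf sub] by (simp add: filterlim_at_top)
    ultimately have "eventually (\<lambda>k. multiplier (t k) $ i = 0) sequentially"
    proof eventually_elim
      case (elim k)
      have "lam (t k) * g (x (t k)) $ i \<le> lam (t k) * (- \<delta>)"
        using elim(1) lam_pos[of "t k"] by (intro mult_left_mono) auto
      moreover have "B \<le> lam (t k) * \<delta>" using elim(2) \<delta> by (simp add: field_simps)
      moreover have "z (t k) $ i \<le> B"
        using component_le_norm_cart[of "z (t k)" i] B(2)[of "t k"] by linarith
      ultimately show ?case by (simp add: multiplier_def pos_part_def)
    qed
    then have "(\<lambda>k. multiplier (t k) $ i) \<longlonglongrightarrow> 0" by (rule tendsto_eventually)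
    then have "zbar $ i = 0" using wi[of i] LIMSEQ_unique by blast
    then show ?thesis by simp
  qed simp
  then have "inner zbar (g xbar) = 0" by (auto simp: inner_vec_def intro!: sum.neutral)
  ultimately show ?thesis unfolding KKT_point_def by blast
qed

text \<open>The subsequence is the one along which the gap vanishes; a cluster point is reached
  along a further subsequence, which inherits this limit.\<close>

lemma KKT_subseq:
  "\<exists>r. strict_mono r \<and> (\<forall>xbar zbar.
     cluster_point ((\<lambda>k. (x k, multiplier k)) \<circ> r) (xbar, zbar) \<longrightarrow> KKT_point f h g xbar zbar)"
proof -
  obtain r where r: "strict_mono r" "(gap \<circ> r) \<longlonglongrightarrow> 0" using gap_subseq by blast
  have "KKT_point f h g xbar zbar"
    if cl: "cluster_point ((\<lambda>k. (x k, multiplier k)) \<circ> r) (xbar, zbar)" for xbar zbar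
  proof -
    obtain s where s: "strict_mono s"
        "(\<lambda>k. (x (r (s k)), multiplier (r (s k)))) \<longlonglongrightarrow> (xbar, zbar)"
      using cl by (auto simp: cluster_point_def o_def)
    show ?thesis
    proof (rule KKT_limit)
      show "strict_mono (r \<circ> s)" using r(1) s(1) by (rule strict_mono_o)
      show "(\<lambda>k. x ((r \<circ> s) k)) \<longlonglongrightarrow> xbar" using tendsto_fst[OF s(2)] by simp
      show "(\<lambda>k. multiplier ((r \<circ> s) k)) \<longlonglongrightarrow> zbar" using tendsto_snd[OF s(2)] by simp
      show "(\<lambda>k. gap ((r \<circ> s) k)) \<longlonglongrightarrow> 0"
        using LIMSEQ_subseq_LIMSEQ[OF r(2) s(1)] by (simp add: o_def)
    qed
  qed
  with r(1) show ?thesis by blast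
qed

lemma objective_bigo:
  "(\<lambda>k. max \<bar>real_of_ereal (objective f h (x k)) - real_of_ereal (optimal_value f h g)\<bar>
          (norm (pos_part (g (x k)))))
     \<in> O(\<lambda>k. max (real k powr (-(p - tau))) (real k powr (-tau)))"
proof -
  obtain C where C: "C \<ge> 0" "eventually (\<lambda>k. \<bar>f (x k) + H (x k) - Lstar\<bar> \<le> C * real k powr (-q) \<and>
     norm (pos_part (g (x k))) \<le> C * real k powr (-q)) sequentially"
    using convergence_rate by blast
  have obj: "real_of_ereal (objective f h (x k)) = f (x k) + H (x k)" for k
    by (rule dom_real[OF x_dom[of k]]) (simp add: objective_def)
  show ?thesis
  proof (rule bigoI[where c = C], use C(2) in eventually_elim)
    case (elim k)
    have "C * real k powr (-q) \<le> C * max (real k powr (-(p - tau))) (real k powr (-tau))"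
      using C(1) by (intro mult_left_mono) (auto simp: q_def min_def)
    moreover have "0 \<le> max (real k powr (-(p - tau))) (real k powr (-tau))"
      by (simp add: le_max_iff_disj)
    ultimately show ?case
      using elim by (simp only: obj optimal_value_eq real_norm_def real_of_ereal.simps(1) abs_of_nonneg) simp
  qed
qed

lemma objective_finite: "\<bar>objective f h (x k)\<bar> \<noteq> \<infinity>"
  by (rule dom_real[OF x_dom[of k]]) (simp add: objective_def)

end

theorem theorem4p1:
  fixes f :: "real ^ 'n \<Rightarrow> real" and h :: "real ^ 'n \<Rightarrow> ereal"
    and g :: "real ^ 'n \<Rightarrow> real ^ 'm"
    and Lf D :: real and Lg :: "'m \<Rightarrow> real"
    and xstar :: "real ^ 'n" and zstar :: "real ^ 'm"
    and lam sig alpha :: "nat \<Rightarrow> real" and tau p gam :: real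
    and v x :: "nat \<Rightarrow> real ^ 'n" and z :: "nat \<Rightarrow> real ^ 'm"
  assumes f_convex: "convex_on UNIV f"
    and f_diff: "\<forall>y. f differentiable (at y)"
    and Lf_pos: "Lf > 0"
    and f_smooth: "Lf-lipschitz_on UNIV (gradient f)"
    and h_proper: "proper_fun h"
    and h_closed: "closed_fun h"
    and h_convex: "convex_fun h"
    and D_pos: "D > 0"
    and dom_diam: "\<forall>y\<in>effective_domain h. \<forall>y'\<in>effective_domain h. norm (y - y') \<le> D"
    and h_argmin: "\<forall>u. linear_argmin h u \<noteq> {}"
    and g_convex: "\<forall>i. convex_on UNIV (\<lambda>y. g y $ i)"
    and g_diff: "\<forall>i y. (\<lambda>y. g y $ i) differentiable (at y)"
    and Lg_pos: "\<forall>i. Lg i > 0"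
    and g_smooth: "\<forall>i. (Lg i)-lipschitz_on (effective_domain h) (gradient (\<lambda>y. g y $ i))"
    and KKT_exists: "KKT_point f h g xstar zstar"
    and lam_pos: "\<forall>k. lam k > 0"
    and lam_incr: "strict_mono lam"
    and lam_inf: "filterlim lam at_top sequentially"
    and tau: "0 < tau" "tau < 1"
    and lam_rate: "lam \<in> \<Theta>(\<lambda>k. real k powr tau)"
    and lam_diff: "(\<lambda>k. lam (Suc k) - lam k) \<in> O(\<lambda>k. real k powr (-(1 - tau)))"
    and alpha_range: "\<forall>k. 0 < alpha k \<and> alpha k \<le> 1"
    and alpha_noninc: "decseq alpha"
    and p: "tau < p" "p < 1"
    and alpha_rate: "alpha \<in> \<Theta>(\<lambda>k. real k powr (-p))"
    and sig_pos: "\<forall>k. sig k > 0"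
    and sig_le: "\<forall>k. sig k \<le> lam k"
    and sig_summable: "summable sig"
    and gam_pos: "gam > 0"
    and sig_rate: "sig \<in> \<Theta>(\<lambda>k. real k powr (-(1 + gam)))"
    and run: "single_loop_run f h g lam sig alpha v x z"
  shows "(\<bar>optimal_value f h g\<bar> \<noteq> \<infinity> \<and> (\<forall>k. \<bar>objective f h (x k)\<bar> \<noteq> \<infinity>) \<and>
          (\<lambda>k. max \<bar>real_of_ereal (objective f h (x k)) - real_of_ereal (optimal_value f h g)\<bar>
                   (norm (pos_part (g (x k)))))
            \<in> O(\<lambda>k. max (real k powr (-(p - tau))) (real k powr (-tau)))) \<and>
         ((\<exists>y\<in>effective_domain h. \<forall>i. g y $ i < 0) \<longrightarrow>
            (\<exists>r. strict_mono r \<and>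
               (\<forall>xbar zbar.
                  cluster_point ((\<lambda>k. (x k, pos_part (lam k *\<^sub>R g (x k) + z k))) \<circ> r) (xbar, zbar)
                    \<longrightarrow> KKT_point f h g xbar zbar)))"
proof -
  interpret single_loop_rates f h g Lf D Lg xstar zstar lam sig alpha v x z tau p gam
  proof unfold_locales
    show "mono lam" using lam_incr by (rule strict_mono_mono)
    show "0 \<le> alpha k \<and> alpha k \<le> 1" "0 < alpha k" for k
      using alpha_range by (simp_all add: less_imp_le)
    show "0 \<le> sig k" for k using sig_pos by (simp add: less_imp_le)
    show "norm (y - y') \<le> D" if "y \<in> effective_domain h" "y' \<in> effective_domain h" for y y'
      using dom_diam that by blast
  qed (rule assms assms[rule_format])+
  show ?thesis
    by (intro conjI allI impI objective_bigo objective_finite KKT_subseq[unfolded multiplier_def])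
      (simp add: optimal_value_eq)
qed

end
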